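(* Let $K$ be a henselian field with $K\neq K(p)$ for some prime $p$. Then the canonical $p$-henselian valuation $v_K^p$ is henselian if and only if $v_K^p$ coarsens the canonical henselian valuation $v_K$ (not necessarily properly), i.e. $\mathcal{O}_{v_K}\subseteq \mathcal{O}_{v_K^p}$.
   Context: A field is henselian if it admits some non-trivial henselian valuation. For a valuation $v$ on $K$, $\mathcal{O}_v$ is the valuation ring and $Kv$ the residue field. $v$ is finer than $w$ (and $w$ coarser than $v$) if $\mathcal{O}_v\subseteq\mathcal{O}_w$. For a field $F$ and a prime $p$, $F(p)$ is the compositum of all Galois extensions of $F$ of $p$-power degree; a valuation on $F$ is $p$-henselian if it extends uniquely to $F(p)$. Canonical henselian valuation $v_K$: let $H_1(K)$ be the set of henselian valuations $v$ on $K$ (the trivial one included) with $Kv$ not separably closed, and $H_2(K)$ the set of those with $Kv$ separably closed. Every valuation in $H_2(K)$ is strictly finer than every one in $H_1(K)$, and any two in $H_1(K)$ are comparable. If $H_2(K)\neq\emptyset$, then $v_K$ is the unique coarsest valuation in $H_2(K)$; otherwise $v_K$ is the unique finest valuation in $H_1(K)$. Canonical $p$-henselian valuation $v_K^p$: let $H_1^p(K)$ be the set of $p$-henselian valuations $v$ on $K$ (the trivial one included) with $Kv\neq Kv(p)$, and $H_2^p(K)$ the set of those with $Kv=Kv(p)$. Every valuation in $H_2^p(K)$ is strictly finer than every one in $H_1^p(K)$, and any two in $H_1^p(K)$ are comparable. If $H_2^p(K)\neq\emptyset$, then $v_K^p$ is the unique coarsest valuation in $H_2^p(K)$; otherwise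 $v_K^p$ is the unique finest valuation in $H_1^p(K)$. *)

theory Defs
  imports "HOL-Algebra.Algebra"
begin

section \<open>Algebraic extensions inside a fixed algebraic closure\<close>

text \<open>
  Every algebraic extension of a field \<open>F\<close> is isomorphic over \<open>F\<close> to a subfield of the library's
  algebraic closure \<open>field.alg_closure F\<close>. The latter contains \<open>F\<close> through the embedding
  \<open>ring.indexed_const F\<close>, not as a subset, so \<open>base F\<close> is the copy of \<open>F\<close> inside it.
\<close>

abbreviation emb :: "('a, 'm) ring_scheme \<Rightarrow> 'a \<Rightarrow> (('a list \<times> nat) multiset \<Rightarrow> 'a)"
  where "emb F \<equiv> ring.indexed_const F"

definition base :: "('a, 'm) ring_scheme \<Rightarrow> (('a list \<times> nat) multiset \<Rightarrow> 'a) set"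
  where "base F = emb F ` carrier F"

definition algebraic_extension ::
    "('a, 'm) ring_scheme \<Rightarrow> (('a list \<times> nat) multiset \<Rightarrow> 'a) set \<Rightarrow> bool"
  where "algebraic_extension F L \<longleftrightarrow> subfield L (field.alg_closure F) \<and> base F \<subseteq> L"

definition min_poly ::
    "('a, 'm) ring_scheme \<Rightarrow> (('a list \<times> nat) multiset \<Rightarrow> 'a)
      \<Rightarrow> (('a list \<times> nat) multiset \<Rightarrow> 'a) list"
  where "min_poly F x = ring.Irr (field.alg_closure F) (base F) x"

definition separable_elt ::
    "('a, 'm) ring_scheme \<Rightarrow> (('a list \<times> nat) multiset \<Rightarrow> 'a) \<Rightarrow> bool"
  where "separable_elt F x \<longleftrightarrow>
    (\<forall>y \<in> carrier (field.alg_closure F). ring.alg_mult (field.alg_closure F) (min_poly F x) y \<le> 1)"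

definition separable_closure ::
    "('a, 'm) ring_scheme \<Rightarrow> (('a list \<times> nat) multiset \<Rightarrow> 'a) set"
  where "separable_closure F = {x \<in> carrier (field.alg_closure F). separable_elt F x}"

definition separably_closed :: "('a, 'm) ring_scheme \<Rightarrow> bool"
  where "separably_closed F \<longleftrightarrow> separable_closure F = base F"

definition separable_extension ::
    "('a, 'm) ring_scheme \<Rightarrow> (('a list \<times> nat) multiset \<Rightarrow> 'a) set \<Rightarrow> bool"
  where "separable_extension F L \<longleftrightarrow> algebraic_extension F L \<and> (\<forall>x \<in> L. separable_elt F x)"

definition normal_extension ::
    "('a, 'm) ring_scheme \<Rightarrow> (('a list \<times> nat) multiset \<Rightarrow> 'a) set \<Rightarrow> bool"
  where "normal_extension F L \<longleftrightarrow> algebraic_extension F L \<and>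
    (\<forall>x \<in> L. \<forall>y \<in> carrier (field.alg_closure F).
       ring.is_root (field.alg_closure F) (min_poly F x) y \<longrightarrow> y \<in> L)"

definition galois_extension ::
    "('a, 'm) ring_scheme \<Rightarrow> (('a list \<times> nat) multiset \<Rightarrow> 'a) set \<Rightarrow> bool"
  where "galois_extension F L \<longleftrightarrow> normal_extension F L \<and> separable_extension F L"

definition galois_p_extension ::
    "('a, 'm) ring_scheme \<Rightarrow> nat \<Rightarrow> (('a list \<times> nat) multiset \<Rightarrow> 'a) set \<Rightarrow> bool"
  where "galois_p_extension F p L \<longleftrightarrow> galois_extension F L \<and>
    (\<exists>n. ring.dimension (field.alg_closure F) (p ^ n) (base F) L)"

text \<open>The field \<open>F(p)\<close>, and the property \<open>F = F(p)\<close>.\<close>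

definition p_closure ::
    "('a, 'm) ring_scheme \<Rightarrow> nat \<Rightarrow> (('a list \<times> nat) multiset \<Rightarrow> 'a) set"
  where "p_closure F p =
    generate_field (field.alg_closure F) (\<Union>{L. galois_p_extension F p L})"

definition p_closed :: "('a, 'm) ring_scheme \<Rightarrow> nat \<Rightarrow> bool"
  where "p_closed F p \<longleftrightarrow> p_closure F p = base F"


section \<open>Valuations\<close>

text \<open>
  Valuations are taken up to equivalence, as is needed for the canonical valuations to be unique,
  and an equivalence class is represented by its valuation ring \<open>V\<close>. The trivial valuation is
  \<open>carrier K\<close>; the valuation with ring \<open>V\<close> is finer than the one with ring \<open>W\<close> iff \<open>V \<subseteq> W\<close>.
\<close>

definition valuation_ring :: "('a, 'm) ring_scheme \<Rightarrow> 'a set \<Rightarrow> bool"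
  where "valuation_ring K V \<longleftrightarrow> subring V K \<and>
    (\<forall>x \<in> carrier K - {\<zero>\<^bsub>K\<^esub>}. x \<in> V \<or> inv\<^bsub>K\<^esub> x \<in> V)"

definition residue_field :: "('a, 'm) ring_scheme \<Rightarrow> 'a set \<Rightarrow> 'a set ring"
  where "residue_field K V = (K\<lparr>carrier := V\<rparr>) Quot (V - Units (K\<lparr>carrier := V\<rparr>))"

text \<open>\<open>W\<close> is (the ring of) a prolongation of \<open>V\<close> to the algebraic extension \<open>L\<close> of \<open>K\<close>.\<close>

definition prolongation ::
    "('a, 'm) ring_scheme \<Rightarrow> 'a set \<Rightarrow> (('a list \<times> nat) multiset \<Rightarrow> 'a) set
      \<Rightarrow> (('a list \<times> nat) multiset \<Rightarrow> 'a) set \<Rightarrow> bool"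
  where "prolongation K V L W \<longleftrightarrow>
    valuation_ring ((field.alg_closure K)\<lparr>carrier := L\<rparr>) W \<and> W \<inter> base K = emb K ` V"

definition henselian :: "('a, 'm) ring_scheme \<Rightarrow> 'a set \<Rightarrow> bool"
  where "henselian K V \<longleftrightarrow> valuation_ring K V \<and>
    (\<forall>L. algebraic_extension K L \<longrightarrow> (\<exists>!W. prolongation K V L W))"

definition p_henselian :: "('a, 'm) ring_scheme \<Rightarrow> nat \<Rightarrow> 'a set \<Rightarrow> bool"
  where "p_henselian K p V \<longleftrightarrow> valuation_ring K V \<and>
    (\<exists>!W. prolongation K V (p_closure K p) W)"

definition henselian_field :: "('a, 'm) ring_scheme \<Rightarrow> bool"
  where "henselian_field K \<longleftrightarrow> field K \<and> (\<exists>V. henselian K V \<and> V \<noteq> carrier K)"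


section \<open>Canonical valuations\<close>

definition H1 :: "('a, 'm) ring_scheme \<Rightarrow> 'a set set"
  where "H1 K = {V. henselian K V \<and> \<not> separably_closed (residue_field K V)}"

definition H2 :: "('a, 'm) ring_scheme \<Rightarrow> 'a set set"
  where "H2 K = {V. henselian K V \<and> separably_closed (residue_field K V)}"

definition H1p :: "('a, 'm) ring_scheme \<Rightarrow> nat \<Rightarrow> 'a set set"
  where "H1p K p = {V. p_henselian K p V \<and> \<not> p_closed (residue_field K V) p}"

definition H2p :: "('a, 'm) ring_scheme \<Rightarrow> nat \<Rightarrow> 'a set set"
  where "H2p K p = {V. p_henselian K p V \<and> p_closed (residue_field K V) p}"

definition coarsest_in :: "'a set set \<Rightarrow> 'a set \<Rightarrow> bool"
  where "coarsest_in H V \<longleftrightarrow> V \<in> H \<and> (\<forall>W \<in> H. W \<subseteq> V)"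

definition finest_in :: "'a set set \<Rightarrow> 'a set \<Rightarrow> bool"
  where "finest_in H V \<longleftrightarrow> V \<in> H \<and> (\<forall>W \<in> H. V \<subseteq> W)"

text \<open>
  The canonical valuations are specified relationally: the predicates below hold for at most one
  ring, see the uniqueness lemmas.
\<close>

definition canonical_henselian_valuation :: "('a, 'm) ring_scheme \<Rightarrow> 'a set \<Rightarrow> bool"
  where "canonical_henselian_valuation K V \<longleftrightarrow>
    (if H2 K \<noteq> {} then coarsest_in (H2 K) V else finest_in (H1 K) V)"

definition canonical_p_henselian_valuation :: "('a, 'm) ring_scheme \<Rightarrow> nat \<Rightarrow> 'a set \<Rightarrow> bool"
  where "canonical_p_henselian_valuation K p V \<longleftrightarrow>
    (if H2p K p \<noteq> {} then coarsest_in (H2p K p) V else finest_in (H1p K p) V)"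

lemma canonical_henselian_valuation_unique:
  assumes "canonical_henselian_valuation K V" and "canonical_henselian_valuation K W"
  shows "V = W"
  using assms unfolding canonical_henselian_valuation_def coarsest_in_def finest_in_def
  by (auto split: if_splits)

lemma canonical_p_henselian_valuation_unique:
  assumes "canonical_p_henselian_valuation K p V" and "canonical_p_henselian_valuation K p W"
  shows "V = W"
  using assms unfolding canonical_p_henselian_valuation_def coarsest_in_def finest_in_def
  by (auto split: if_splits)

end

theory Submission
  imports Defs
begin

text \<open>
  A coarsening \<open>W\<close> of a henselian \<open>V\<close> is henselian: by Chevalley's theorem each prolongation of \<open>W\<close>
  to an algebraic extension contains a prolongation of \<open>V\<close>. The latter being unique, any two
  prolongations of \<open>W\<close> are overrings of one valuation ring, hence comparable, and comparable
  prolongations to an algebraic extension coincide. Conversely, suppose that \<open>v\<^sub>K\<^sup>p\<close> is henselian. If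
  \<open>H\<^sub>2(K)\<close> is empty, then \<open>v\<^sub>K\<^sup>p\<close> lies in \<open>H\<^sub>1(K)\<close>, of which \<open>v\<^sub>K\<close> is the finest element. Otherwise the
  residue field of \<open>v\<^sub>K\<close> is separably closed, so \<open>v\<^sub>K\<close> lies in \<open>H\<^sub>2\<^sup>p(K)\<close>, of which \<open>v\<^sub>K\<^sup>p\<close> is the coarsest
  element.
\<close>

section \<open>Chevalley's extension theorem\<close>

text \<open>For a valuation ring \<open>W\<close> this is its maximal ideal, and
  \<open>W - nonunits R W\<close> is its unit group. Zero has a disjunct of its own because its
  \<open>inv\<close> is an unspecified value.\<close>

definition nonunits :: "('a, 'm) ring_scheme \<Rightarrow> 'a set \<Rightarrow> 'a set"
  where "nonunits R W = {x \<in> W. x = \<zero>\<^bsub>R\<^esub> \<or> inv\<^bsub>R\<^esub> x \<notin> W}"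

text \<open>A subring \<open>B\<close> together with a proper ideal \<open>J\<close> of
  \<open>B\<close>; negatives in \<open>J\<close> come from multiplication by -1. Except for
  \<open>subring B R\<close> the conditions mention only elements and operations, so they read the
  same in a subfield.\<close>

definition proper_pair :: "('a, 'm) ring_scheme \<Rightarrow> 'a set \<Rightarrow> 'a set \<Rightarrow> bool"
  where "proper_pair R B J \<longleftrightarrow> subring B R \<and> J \<subseteq> B \<and> \<zero>\<^bsub>R\<^esub> \<in> J \<and> \<one>\<^bsub>R\<^esub> \<notin> J \<and>
    (\<forall>a \<in> J. \<forall>b \<in> J. a \<oplus>\<^bsub>R\<^esub> b \<in> J) \<and> (\<forall>b \<in> B. \<forall>a \<in> J. b \<otimes>\<^bsub>R\<^esub> a \<in> J)"

text \<open>The values at \<open>x\<close> of polynomials of degree at most \<open>n\<close> with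
  coefficients in \<open>J\<close>, in Horner form. It refines \<open>simple_extension J x\<close>
  by a degree bound, on which the descent below rests.\<close>

primrec polys_upto :: "('a, 'm) ring_scheme \<Rightarrow> 'a set \<Rightarrow> 'a \<Rightarrow> nat \<Rightarrow> 'a set"
  where
    "polys_upto R J x 0 = J"
  | "polys_upto R J x (Suc n) = {(q \<otimes>\<^bsub>R\<^esub> x) \<oplus>\<^bsub>R\<^esub> a | q a. q \<in> polys_upto R J x n \<and> a \<in> J}"

context field
begin

section \<open>Pairs of a subring and a proper ideal; adjoining an element\<close>

lemma proper_pairD:
  assumes "proper_pair R B J"
  shows "subring B R" "B \<subseteq> carrier R" "J \<subseteq> B" "\<zero> \<in> J" "\<one> \<notin> J" "J \<subseteq> carrier R" "\<one> \<in> B"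
    and "\<And>a b. a \<in> J \<Longrightarrow> b \<in> J \<Longrightarrow> a \<oplus> b \<in> J"
    and "\<And>b a. b \<in> B \<Longrightarrow> a \<in> J \<Longrightarrow> b \<otimes> a \<in> J"
    and "\<And>b a. b \<in> B \<Longrightarrow> a \<in> J \<Longrightarrow> a \<otimes> b \<in> J"
    and "\<And>a. a \<in> J \<Longrightarrow> \<ominus> a \<in> J"
proof -
  show S: "subring B R" "J \<subseteq> B" "\<zero> \<in> J" "\<one> \<notin> J"
    "\<And>a b. a \<in> J \<Longrightarrow> b \<in> J \<Longrightarrow> a \<oplus> b \<in> J"
    and M: "\<And>b a. b \<in> B \<Longrightarrow> a \<in> J \<Longrightarrow> b \<otimes> a \<in> J"
    using assms by (auto simp: proper_pair_def)
  show C: "B \<subseteq> carrier R" "J \<subseteq> carrier R" "\<one> \<in> B"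
    using S(2) subringE(1,3)[OF S(1)] by auto
  show "a \<otimes> b \<in> J" if "b \<in> B" "a \<in> J" for a b
    using M[OF that] C(1,2) that m_comm by (metis subsetD)
  show "\<ominus> a \<in> J" if "a \<in> J" for a
  proof -
    have "\<ominus> \<one> \<in> B" using subringE(5)[OF S(1) C(3)] .
    moreover have "\<ominus> \<one> \<otimes> a = \<ominus> a" using that C by (auto simp: l_minus)
    ultimately show ?thesis using M that by metis
  qed
qed

lemma polys_upto_in_carrier:
  assumes "J \<subseteq> carrier R" "x \<in> carrier R"
  shows "polys_upto R J x n \<subseteq> carrier R"
  using assms by (induct n) auto

lemma simple_extension_imp_polys_upto:
  assumes "\<zero> \<in> J" "x \<in> carrier R" "J \<subseteq> carrier R" "q \<in> simple_extension J x"
  shows "\<exists>n. q \<in> polys_upto R J x n"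
  using assms(4)
proof (induct rule: simple_extension.induct)
  case zero
  then show ?case using assms(1) by (metis polys_upto.simps(1))
next
  case (lin k1 k2)
  then obtain n where "k1 \<in> polys_upto R J x n" by blast
  then have "k1 \<otimes> x \<oplus> k2 \<in> polys_upto R J x (Suc n)" using lin by auto
  then show ?case by blast
qed

lemma simple_extension_contains:
  assumes "J \<subseteq> carrier R" "x \<in> carrier R" "a \<in> J"
  shows "a \<in> simple_extension J x"
  using simple_extension.lin[OF simple_extension.zero assms(3), of x] assms by auto

lemma simple_extension_carrier:
  assumes "J \<subseteq> carrier R" "x \<in> carrier R" "q \<in> simple_extension J x"
  shows "q \<in> carrier R"
  using assms(3) by (induct) (use assms in auto)

text \<open>\<open>J[x]\<close> is an ideal of \<open>B[x]\<close> by induction along the Horner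
  form, so only the absence of 1 has to be assumed.\<close>

lemma simple_extension_proper_pair:
  assumes P: "proper_pair R B J" and x: "x \<in> carrier R" and one: "\<one> \<notin> simple_extension J x"
  shows "proper_pair R (simple_extension B x) (simple_extension J x)"
proof -
  note D = proper_pairD[OF P]
  note C = simple_extension_carrier[OF D(6) x] simple_extension_carrier[OF D(2) x]
  have sub: "simple_extension J x \<subseteq> simple_extension B x"
  proof
    fix q assume "q \<in> simple_extension J x"
    then show "q \<in> simple_extension B x"
      by induct (use D(3) in \<open>auto intro: simple_extension.intros\<close>)
  qed
  have add: "q \<oplus> r \<in> simple_extension J x" if "q \<in> simple_extension J x" "r \<in> simple_extension J x" for q r
    using that
  proof (induct q arbitrary: r rule: simple_extension.induct)
    case zero
    then show ?case using C by auto
  next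
    case (lin q a)
    from lin(4) show ?case
    proof cases
      case zero
      then show ?thesis using lin C D(6) x by (auto intro!: simple_extension.lin)
    next
      case (lin q' a')
      have "(q \<otimes> x \<oplus> a) \<oplus> (q' \<otimes> x \<oplus> a') = (q \<oplus> q') \<otimes> x \<oplus> (a \<oplus> a')"
      proof -
        have "q \<in> carrier R" "q' \<in> carrier R" "a \<in> carrier R" "a' \<in> carrier R"
          using C(1) \<open>q \<in> simple_extension J x\<close> lin D(6) \<open>a \<in> J\<close> by auto
        then show ?thesis using x by algebra
      qed
      then show ?thesis using lin \<open>a \<in> J\<close>
        by (auto intro!: simple_extension.lin D(8) \<open>\<And>r. r \<in> simple_extension J x \<Longrightarrow> q \<oplus> r \<in> simple_extension J x\<close>)
    qed
  qed
  have scal: "b \<otimes> r \<in> simple_extension J x" if b: "b \<in> B" and "r \<in> simple_extension J x" for b r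
    using that(2)
  proof induct
    case zero
    then show ?case using b D(2) by auto
  next
    case (lin q a)
    have "q \<in> carrier R" "a \<in> carrier R" "b \<in> carrier R"
      using C(1) lin D b by auto
    then have "b \<otimes> (q \<otimes> x \<oplus> a) = (b \<otimes> q) \<otimes> x \<oplus> b \<otimes> a"
      using x by algebra
    then show ?case using lin b by (auto intro!: simple_extension.lin D(9))
  qed
  have mult: "b \<otimes> r \<in> simple_extension J x"
    if "b \<in> simple_extension B x" and r: "r \<in> simple_extension J x" for b r
    using that(1)
  proof induct
    case zero
    then show ?case using C r by auto
  next
    case (lin q a)
    have c: "q \<in> carrier R" "a \<in> carrier R" "r \<in> carrier R"
      using C lin D r by auto
    \<comment> \<open>The zero coefficient turns the shift of \<open>q \<otimes> r\<close> by
      \<open>x\<close> into a Horner step.\<close>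
    then have "(q \<otimes> x \<oplus> a) \<otimes> r = ((q \<otimes> r) \<otimes> x \<oplus> \<zero>) \<oplus> a \<otimes> r"
      using x by algebra
    then show ?case using lin r D(4) by (auto intro!: add scal simple_extension.lin)
  qed
  show ?thesis
    unfolding proper_pair_def
    using simple_extension_is_subring[OF D(1) x] sub add mult one by auto
qed

section \<open>Maximal pairs are valuation rings\<close>

definition maximal_pair :: "'a set \<Rightarrow> 'a set \<Rightarrow> bool"
  where "maximal_pair B J \<longleftrightarrow> proper_pair R B J \<and>
    (\<forall>B' J'. proper_pair R B' J' \<longrightarrow> B \<subseteq> B' \<longrightarrow> J \<subseteq> J' \<longrightarrow> B' \<subseteq> B)"

text \<open>If 1 were not in \<open>J[x]\<close>, then \<open>(B[x], J[x])\<close> would be a proper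
  pair above \<open>(B, J)\<close>, and maximality would put \<open>x\<close> into
  \<open>B\<close>.\<close>

lemma maximal_pair_adjoin:
  assumes M: "maximal_pair B J" and x: "x \<in> carrier R" "x \<notin> B"
  obtains n where "\<one> \<in> polys_upto R J x n"
proof -
  have P: "proper_pair R B J" using M by (simp add: maximal_pair_def)
  note D = proper_pairD[OF P]
  have "\<one> \<in> simple_extension J x"
  proof (rule ccontr)
    assume "\<one> \<notin> simple_extension J x"
    from simple_extension_proper_pair[OF P x(1) this]
    have "simple_extension B x \<subseteq> B"
      using M simple_extension_contains[OF _ x(1)] D unfolding maximal_pair_def
      by (meson subsetI)
    moreover have "x \<in> simple_extension B x"
      using simple_extension.lin[OF simple_extension_contains[OF D(2) x(1) D(7)], of \<zero>] D(1) x(1)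
        subringE(2)[of B R] by auto
    ultimately show False using x by auto
  qed
  then show thesis using simple_extension_imp_polys_upto[of J x \<one>] D x that by auto
qed

text \<open>Each power of \<open>y = 1/u\<close> is cancelled by a power of \<open>u\<close>, which
  leaves a \<open>B\<close>-linear combination of elements of \<open>J\<close>.\<close>

lemma polys_upto_clear_denominators:
  assumes P: "proper_pair R B J" and u: "u \<in> B" and y: "y \<in> carrier R" "u \<otimes> y = \<one>"
    and "q \<in> polys_upto R J y n"
  shows "u [^] n \<otimes> q \<in> J"
  using assms(5)
proof (induct n arbitrary: q)
  case 0
  then show ?case using proper_pairD[OF P] by auto
next
  case (Suc n)
  note D = proper_pairD[OF P]
  from Suc(2) obtain r a where q: "q = (r \<otimes> y) \<oplus> a" and r: "r \<in> polys_upto R J y n" and a: "a \<in> J"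
    by auto
  have c: "r \<in> carrier R" "a \<in> carrier R" "u \<in> carrier R"
    using polys_upto_in_carrier[OF D(6) y(1)] r a u D by auto
  have up: "u [^] Suc n \<in> B" 
    using u D(1) subringE[OF D(1)] by (induct n) auto
  have "u [^] Suc n \<otimes> q = (u [^] n \<otimes> r) \<otimes> (u \<otimes> y) \<oplus> u [^] Suc n \<otimes> a"
  proof -
    have "u [^] n \<in> carrier R" using c by auto
    then show ?thesis unfolding q nat_pow_Suc using c y(1) by algebra
  qed
  also have "\<dots> = u [^] n \<otimes> r \<oplus> u [^] Suc n \<otimes> a"
    using c y by simp
  also have "\<dots> \<in> J"
    using Suc(1)[OF r] a up D by auto
  finally show ?case .
qed

text \<open>If the inverse of \<open>u = 1 - b\<close> were missing from \<open>B\<close>, then 1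
  would be a polynomial in \<open>1/u\<close> over \<open>J\<close>. Clearing denominators gives
  \<open>u^n\<close> in \<open>J\<close>, yet \<open>u^n\<close> is congruent to 1 modulo
  \<open>J\<close>, so 1 would lie in \<open>J\<close>.\<close>

lemma maximal_pair_one_minus_unit:
  assumes M: "maximal_pair B J" and b: "b \<in> J"
  shows "\<one> \<ominus> b \<noteq> \<zero>" and "inv (\<one> \<ominus> b) \<in> B"
proof -
  have P: "proper_pair R B J" using M by (simp add: maximal_pair_def)
  note D = proper_pairD[OF P]
  let ?u = "\<one> \<ominus> b"
  have bc: "b \<in> carrier R" using b D by auto
  show nz: "?u \<noteq> \<zero>"
  proof
    assume "?u = \<zero>"
    then have "b = \<one>" using bc by simp
    then show False using D b by auto
  qed
  have diff: "\<one> \<ominus> j \<in> B" if "j \<in> J" for j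
    using that D(3,7) subringE(5,7)[OF D(1)] unfolding a_minus_def by blast
  then have uB: "?u \<in> B" using b .
  have uc: "?u \<in> carrier R" using bc by auto
  have inv: "inv ?u \<in> carrier R" "?u \<otimes> inv ?u = \<one>"
    using nz uc by (auto simp: field_Units)
  show "inv ?u \<in> B"
  proof (rule ccontr)
    assume "inv ?u \<notin> B"
    from maximal_pair_adjoin[OF M inv(1) this] obtain n
      where "\<one> \<in> polys_upto R J (inv ?u) n" .
    from polys_upto_clear_denominators[OF P uB inv this]
    have un: "?u [^] n \<in> J" using uc by simp
    \<comment> \<open>Powers of \<open>1 - b\<close> stay congruent to 1 modulo
      \<open>J\<close>.\<close>
    have "\<exists>j \<in> J. ?u [^] m = \<one> \<ominus> j" for m :: nat
    proof (induct m)
      case 0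
      then show ?case using D(4) by (intro bexI[of _ \<zero>]) (simp_all add: a_minus_def)
    next
      case (Suc m)
      then obtain j where j: "j \<in> J" "?u [^] m = \<one> \<ominus> j" by blast
      have jc: "j \<in> carrier R" using j D by auto
      have "?u [^] Suc m = \<one> \<ominus> (j \<oplus> ?u [^] m \<otimes> b)"
        unfolding nat_pow_Suc j(2) using jc bc by algebra
      moreover have "?u [^] m \<in> B"
        using j diff by simp
      then have "j \<oplus> ?u [^] m \<otimes> b \<in> J"
        using j b D by auto
      ultimately show ?case by blast
    qed
    then obtain j where j: "j \<in> J" "?u [^] n = \<one> \<ominus> j" by blast
    then have "\<one> \<ominus> j \<oplus> j \<in> J" using un D by auto
    moreover have "\<one> \<ominus> j \<oplus> j = \<one>"
      using j(1) D(6) by (subgoal_tac "j \<in> carrier R", algebra, auto)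
    ultimately show False using D by auto
  qed
qed

lemma polys_upto_add:
  assumes P: "proper_pair R B J" and x: "x \<in> carrier R"
    and "q \<in> polys_upto R J x n" "r \<in> polys_upto R J x n"
  shows "q \<oplus> r \<in> polys_upto R J x n"
  using assms(3,4)
proof (induct n arbitrary: q r)
  case 0
  then show ?case using proper_pairD[OF P] by auto
next
  case (Suc n)
  note D = proper_pairD[OF P]
  from Suc(2,3) obtain q' a r' b where
    q: "q = (q' \<otimes> x) \<oplus> a" "q' \<in> polys_upto R J x n" "a \<in> J" and
    r: "r = (r' \<otimes> x) \<oplus> b" "r' \<in> polys_upto R J x n" "b \<in> J" by auto
  have c: "q' \<in> carrier R" "r' \<in> carrier R" "a \<in> carrier R" "b \<in> carrier R"
    using polys_upto_in_carrier[OF D(6) x] q r D by auto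
  have "q \<oplus> r = (q' \<oplus> r') \<otimes> x \<oplus> (a \<oplus> b)"
    unfolding q(1) r(1) using c x by algebra
  then show ?case using Suc(1)[OF q(2) r(2)] D(8)[OF q(3) r(3)] by auto
qed

lemma polys_upto_scale:
  assumes P: "proper_pair R B J" and x: "x \<in> carrier R" and b: "b \<in> B"
    and "q \<in> polys_upto R J x n"
  shows "b \<otimes> q \<in> polys_upto R J x n"
  using assms(4)
proof (induct n arbitrary: q)
  case 0
  then show ?case using proper_pairD[OF P] b by auto
next
  case (Suc n)
  note D = proper_pairD[OF P]
  from Suc(2) obtain q' a where
    q: "q = (q' \<otimes> x) \<oplus> a" "q' \<in> polys_upto R J x n" "a \<in> J" by auto
  have c: "q' \<in> carrier R" "a \<in> carrier R" "b \<in> carrier R"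
    using polys_upto_in_carrier[OF D(6) x] q D b by auto
  have "b \<otimes> q = (b \<otimes> q') \<otimes> x \<oplus> (b \<otimes> a)"
    unfolding q(1) using c x by algebra
  then show ?case using Suc(1)[OF q(2)] D(9)[OF b q(3)] by auto
qed

lemma polys_upto_monom:
  assumes P: "proper_pair R B J" and x: "x \<in> carrier R" and a: "a \<in> J"
  shows "a \<otimes> x [^] n \<in> polys_upto R J x n"
proof (induct n)
  case 0
  then show ?case using a proper_pairD[OF P] by auto
next
  case (Suc n)
  note D = proper_pairD[OF P]
  have c: "a \<in> carrier R" "x [^] n \<in> carrier R" using a D x by auto
  have "a \<otimes> x [^] Suc n = (a \<otimes> x [^] n) \<otimes> x \<oplus> \<zero>"
    unfolding nat_pow_Suc using c x by algebra
  then show ?case using Suc D(4) by auto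
qed

text \<open>The Horner recursion exposes the constant term; the descent needs the leading term
  instead.\<close>

lemma polys_upto_split_top:
  assumes P: "proper_pair R B J" and x: "x \<in> carrier R" and "q \<in> polys_upto R J x (Suc n)"
  obtains r a where "r \<in> polys_upto R J x n" "a \<in> J" "q = r \<oplus> a \<otimes> x [^] Suc n"
proof -
  note D = proper_pairD[OF P]
  have "\<exists>r a. r \<in> polys_upto R J x n \<and> a \<in> J \<and> q = r \<oplus> a \<otimes> x [^] Suc n"
    using assms(3)
  proof (induct n arbitrary: q)
    case 0
    then obtain a b where q: "q = a \<otimes> x \<oplus> b" "a \<in> J" "b \<in> J" by auto
    then have "a \<in> carrier R" "b \<in> carrier R" using D by auto
    then have "q = b \<oplus> a \<otimes> x [^] Suc 0" using q x by (simp add: a_comm)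
    then show ?case using q by auto
  next
    case (Suc n)
    from Suc(2) obtain q' b where q: "q = q' \<otimes> x \<oplus> b" "q' \<in> polys_upto R J x (Suc n)" "b \<in> J"
      by (subst (asm) polys_upto.simps) blast
    from Suc(1)[OF q(2)] obtain r a where r: "r \<in> polys_upto R J x n" "a \<in> J"
      "q' = r \<oplus> a \<otimes> x [^] Suc n" by blast
    have c: "r \<in> carrier R" "b \<in> carrier R" "a \<in> carrier R" "x [^] Suc n \<in> carrier R"
      using polys_upto_in_carrier[OF D(6) x] q r D x by auto
    have "q = (r \<otimes> x \<oplus> b) \<oplus> a \<otimes> x [^] Suc (Suc n)"
      unfolding q(1) r(3) nat_pow_Suc[of x "Suc n"] using c x by algebra
    moreover have "r \<otimes> x \<oplus> b \<in> polys_upto R J x (Suc n)" using r q by auto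
    ultimately show ?case using r by blast
  qed
  then show thesis using that by blast
qed

text \<open>Multiplication by \<open>x^n\<close> turns each \<open>y^i\<close> with
  \<open>i \<le> m\<close> into \<open>x^(n - i)\<close>, and no negative power remains because
  \<open>m \<le> n\<close>.\<close>

lemma polys_upto_inverse:
  assumes P: "proper_pair R B J" and x: "x \<in> carrier R" and y: "y \<in> carrier R" "x \<otimes> y = \<one>"
    and "m \<le> n" "q \<in> polys_upto R J y m"
  shows "x [^] n \<otimes> q \<in> polys_upto R J x n"
  using assms(5,6)
proof (induct m arbitrary: n q)
  case 0
  then have "q \<otimes> x [^] n \<in> polys_upto R J x n"
    using polys_upto_monom[OF P x] by auto
  moreover have "q \<in> carrier R" using 0 proper_pairD[OF P] by auto
  ultimately show ?case using m_comm x by simp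
next
  case (Suc m)
  note D = proper_pairD[OF P]
  from Suc(2) obtain k where n: "n = Suc k" "m \<le> k" by (cases n) auto
  from Suc(3) obtain r a where q: "q = (r \<otimes> y) \<oplus> a" "r \<in> polys_upto R J y m" "a \<in> J" by auto
  have c: "r \<in> carrier R" "a \<in> carrier R" "x [^] k \<in> carrier R" "x [^] n \<in> carrier R"
    using polys_upto_in_carrier[OF D(6) y(1)] q D x by auto
  have "x [^] n \<otimes> q = (x [^] k \<otimes> r) \<otimes> (x \<otimes> y) \<oplus> a \<otimes> x [^] n"
    unfolding q(1) n(1) nat_pow_Suc using c x y(1) by algebra
  also have "\<dots> = x [^] k \<otimes> r \<oplus> a \<otimes> x [^] n" using c y by simp
  finally have e: "x [^] n \<otimes> q = x [^] k \<otimes> r \<oplus> a \<otimes> x [^] n" .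
  \<comment> \<open>The induction hypothesis yields the bound \<open>k\<close>, one below
    \<open>n\<close>; a zero leading coefficient pads it.\<close>
  have mono: "polys_upto R J x k \<subseteq> polys_upto R J x (Suc k)" for k
  proof (induct k)
    case 0
    show ?case
    proof
      fix c assume "c \<in> polys_upto R J x 0"
      then have "c = \<zero> \<otimes> x \<oplus> c" "c \<in> J" using D x by auto
      then show "c \<in> polys_upto R J x (Suc 0)" using D(4) by auto
    qed
  next
    case (Suc k)
    then show ?case by (subst (1 2) polys_upto.simps(2)) blast
  qed
  show ?case
    unfolding e
    using polys_upto_add[OF P x _ polys_upto_monom[OF P x q(3)], of "x [^] k \<otimes> r" n]
      Suc(1)[OF n(2) q(2)] mono[of k] n(1) by auto
qed

text \<open>Lowers the degree of a relation \<open>1 = a\<^sub>0 + \<dots> + a\<^sub>n x\<^sup>n\<close> by means of one in \<open>1/x\<close> whose degree is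
  at most \<open>n\<close>.\<close>

lemma maximal_pair_reduce_relation:
  assumes M: "maximal_pair B J" and x: "x \<in> carrier R" and y: "y \<in> carrier R" "x \<otimes> y = \<one>"
    and "m \<le> n" "\<one> \<in> polys_upto R J x (Suc n)" "\<one> \<in> polys_upto R J y (Suc m)"
  shows "\<one> \<in> polys_upto R J x n"
proof -
  have P: "proper_pair R B J" using M by (simp add: maximal_pair_def)
  note D = proper_pairD[OF P]
  obtain r a where r: "r \<in> polys_upto R J x n" "a \<in> J" "\<one> = r \<oplus> a \<otimes> x [^] Suc n"
    using polys_upto_split_top[OF P x assms(6)] .
  obtain q b where q: "q \<in> polys_upto R J y m" "b \<in> J" "\<one> = q \<otimes> y \<oplus> b"
    using assms(7) by auto
  have c: "r \<in> carrier R" "a \<in> carrier R" "q \<in> carrier R" "b \<in> carrier R" "x [^] n \<in> carrier R"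
    using polys_upto_in_carrier[OF D(6)] r(1,2) q(1,2) D x y by auto
  \<comment> \<open>The inverse of \<open>1 - b\<close> lies in \<open>B\<close>, so the constant
    term of the relation in \<open>y\<close> can be moved to the left and divided out.\<close>
  define u where "u = inv (\<one> \<ominus> b)"
  have uB: "u \<in> B" and u: "u \<otimes> (\<one> \<ominus> b) = \<one>" and uc: "u \<in> carrier R"
    using maximal_pair_one_minus_unit[OF M q(2)] c D unfolding u_def by (auto simp: field_Units)
  have "q \<otimes> y = \<one> \<ominus> b"
  proof -
    have "q \<otimes> y = (q \<otimes> y \<oplus> b) \<ominus> b" using c y(1) by algebra
    then show ?thesis using q(3) by simp
  qed
  \<comment> \<open>1 is now a polynomial in \<open>y\<close> without constant term. Multiplying the
    leading term \<open>a x^(n+1)\<close> by it removes a factor \<open>x\<close>, and the remaining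
    \<open>x^n q\<close> has degree at most \<open>n\<close> in \<open>x\<close>.\<close>
  then have one: "\<one> = u \<otimes> (q \<otimes> y)" using u by simp
  have "a \<otimes> x [^] Suc n = a \<otimes> x [^] Suc n \<otimes> (u \<otimes> (q \<otimes> y))"
    using c x by (simp add: one[symmetric])
  also have "\<dots> = (u \<otimes> a) \<otimes> (x [^] n \<otimes> q) \<otimes> (x \<otimes> y)"
    unfolding nat_pow_Suc using c x y(1) uc by algebra
  also have "\<dots> = (u \<otimes> a) \<otimes> (x [^] n \<otimes> q)"
    using c y uc by simp
  finally have "a \<otimes> x [^] Suc n = (u \<otimes> a) \<otimes> (x [^] n \<otimes> q)" .
  moreover have "u \<otimes> a \<in> B" using D uB r(2) by auto
  ultimately have "a \<otimes> x [^] Suc n \<in> polys_upto R J x n"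
    using polys_upto_scale[OF P x] polys_upto_inverse[OF P x y assms(5) q(1)] by auto
  then show ?thesis using polys_upto_add[OF P x r(1)] r(3) by metis
qed

text \<open>If neither \<open>x\<close> nor \<open>1/x\<close> were in \<open>B\<close>, then 1
  would be a polynomial over \<open>J\<close> in each of them. With both degrees minimal, the
  relation of larger degree can be shortened by the other, a contradiction. An element of
  \<open>J\<close> with its inverse in \<open>B\<close> would put 1 into \<open>J\<close>.\<close>

lemma maximal_pair_valuation_ring:
  assumes M: "maximal_pair B J"
  shows "valuation_ring R B" and "J \<subseteq> nonunits R B"
proof -
  have P: "proper_pair R B J" using M by (simp add: maximal_pair_def)
  note D = proper_pairD[OF P]
  show "J \<subseteq> nonunits R B"
  proof
    fix a assume a: "a \<in> J"
    then have ac: "a \<in> carrier R" using D by auto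
    have "inv a \<notin> B" if "a \<noteq> \<zero>"
      using D(9)[OF _ a, of "inv a"] D(5) that ac by (auto simp: field_Units)
    then show "a \<in> nonunits R B" using a D(3) by (auto simp: nonunits_def)
  qed
  have "x \<in> B \<or> inv x \<in> B" if x: "x \<in> carrier R" "x \<noteq> \<zero>" for x
  proof (rule ccontr)
    assume "\<not> (x \<in> B \<or> inv x \<in> B)"
    then have n: "x \<notin> B" "inv x \<notin> B" by auto
    have y: "inv x \<in> carrier R" "x \<otimes> inv x = \<one>" "inv x \<otimes> x = \<one>"
      using x by (auto simp: field_Units)
    obtain k0 where "\<one> \<in> polys_upto R J x k0" using maximal_pair_adjoin[OF M x(1) n(1)] .
    then obtain k where k: "\<one> \<in> polys_upto R J x k" "\<And>i. i < k \<Longrightarrow> \<one> \<notin> polys_upto R J x i"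
      using exists_least_iff[of "\<lambda>i. \<one> \<in> polys_upto R J x i"] by blast
    obtain l0 where "\<one> \<in> polys_upto R J (inv x) l0" using maximal_pair_adjoin[OF M y(1) n(2)] .
    then obtain l where l: "\<one> \<in> polys_upto R J (inv x) l"
      "\<And>i. i < l \<Longrightarrow> \<one> \<notin> polys_upto R J (inv x) i"
      using exists_least_iff[of "\<lambda>i. \<one> \<in> polys_upto R J (inv x) i"] by blast
    \<comment> \<open>Degree 0 would say that 1 lies in \<open>J\<close>.\<close>
    have "k \<noteq> 0" "l \<noteq> 0"
      using k(1) l(1) D(5) polys_upto.simps(1) by metis+
    then obtain k' l' where s: "k = Suc k'" "l = Suc l'"
      using not0_implies_Suc by blast
    consider "l' \<le> k'" | "k' \<le> l'" by linarith
    then show False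
    proof cases
      case 1
      show ?thesis
        using maximal_pair_reduce_relation[OF M x(1) y(1,2) 1] k(1) l(1) k(2)[of k'] s by simp
    next
      case 2
      show ?thesis
        using maximal_pair_reduce_relation[OF M y(1) x(1) y(3) 2] k(1) l(1) l(2)[of l'] s by simp
    qed
  qed
  then show "valuation_ring R B" using D(1) by (simp add: valuation_ring_def)
qed

lemma exists_maximal_pair:
  assumes "proper_pair R A I"
  obtains B J where "maximal_pair B J" "A \<subseteq> B" "I \<subseteq> J"
proof -
  \<comment> \<open>A pair of sets is encoded as one subset of a sum type, so that Zorn's lemma for inclusion applies.\<close>
  define fs :: "('a + 'a) set \<Rightarrow> 'a set" where "fs S = {x. Inl x \<in> S}" for S
  define sn :: "('a + 'a) set \<Rightarrow> 'a set" where "sn S = {x. Inr x \<in> S}" for S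
  define \<A> where "\<A> = {S. proper_pair R (fs S) (sn S) \<and> A \<subseteq> fs S \<and> I \<subseteq> sn S}"
  have enc: "fs (Sum_Type.Plus B J) = B" "sn (Sum_Type.Plus B J) = J" for B J
    by (auto simp: fs_def sn_def)
  have "Sum_Type.Plus A I \<in> \<A>" using assms by (simp add: \<A>_def enc)
  then have ne: "\<A> \<noteq> {}" by blast
  have "\<exists>S \<in> \<A>. \<forall>T \<in> \<A>. S \<subseteq> T \<longrightarrow> T = S"
  proof (rule subset_Zorn_nonempty[OF ne])
    fix \<C> assume C: "\<C> \<noteq> {}" "subset.chain \<A> \<C>"
    have CA: "S \<in> \<A>" if "S \<in> \<C>" for S using C(2) that by (auto simp: subset_chain_def)
    \<comment> \<open>Each closure condition on a pair involves at most two elements, so a common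
      member of the chain suffices to verify it for the union.\<close>
    have two: "\<exists>S \<in> \<C>. a \<in> S \<and> b \<in> S" if "a \<in> \<Union>\<C>" "b \<in> \<Union>\<C>" for a b
    proof -
      from that obtain S T where "S \<in> \<C>" "T \<in> \<C>" "a \<in> S" "b \<in> T" by blast
      moreover have "S \<subseteq> T \<or> T \<subseteq> S" using C(2) calculation by (auto simp: subset_chain_def)
      ultimately show ?thesis by blast
    qed
    have P: "proper_pair R (fs S) (sn S)" if "S \<in> \<C>" for S
      using CA[OF that] by (simp add: \<A>_def)
    note D = proper_pairD[OF P]
    note E = subringE[OF D(1)]
    obtain S0 where S0: "S0 \<in> \<C>" using C(1) by blast
    have "subring (fs (\<Union>\<C>)) R"
    proof (rule subringI)
      show "fs (\<Union>\<C>) \<subseteq> carrier R" using E(1) by (fastforce simp: fs_def)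
      show "\<one> \<in> fs (\<Union>\<C>)" using E(3)[OF S0] S0 by (auto simp: fs_def)
    next
      fix h assume "h \<in> fs (\<Union>\<C>)"
      then obtain S where "S \<in> \<C>" "h \<in> fs S" by (auto simp: fs_def)
      then show "\<ominus> h \<in> fs (\<Union>\<C>)" using E(5)[of S h] by (auto simp: fs_def)
    next
      fix h1 h2 assume "h1 \<in> fs (\<Union>\<C>)" "h2 \<in> fs (\<Union>\<C>)"
      then have "\<exists>S \<in> \<C>. Inl h1 \<in> S \<and> Inl h2 \<in> S"
        by (intro two) (auto simp: fs_def)
      then obtain S where "S \<in> \<C>" "h1 \<in> fs S" "h2 \<in> fs S" by (auto simp: fs_def)
      then show "h1 \<otimes> h2 \<in> fs (\<Union>\<C>)" "h1 \<oplus> h2 \<in> fs (\<Union>\<C>)"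
        using E(6,7)[of S h1 h2] by (auto simp: fs_def)
    qed
    moreover have "sn (\<Union>\<C>) \<subseteq> fs (\<Union>\<C>)" using D(3) by (fastforce simp: fs_def sn_def)
    moreover have "\<zero> \<in> sn (\<Union>\<C>)" using D(4)[OF S0] S0 by (auto simp: sn_def)
    moreover have "\<one> \<notin> sn (\<Union>\<C>)" using D(5) by (auto simp: sn_def)
    moreover have "a \<oplus> b \<in> sn (\<Union>\<C>)" if "a \<in> sn (\<Union>\<C>)" "b \<in> sn (\<Union>\<C>)" for a b
    proof -
      have "\<exists>S \<in> \<C>. Inr a \<in> S \<and> Inr b \<in> S"
        by (rule two) (use that in \<open>auto simp: sn_def\<close>)
      then obtain S where "S \<in> \<C>" "a \<in> sn S" "b \<in> sn S" by (auto simp: sn_def)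
      then show ?thesis using D(8)[of S a b] by (auto simp: sn_def)
    qed
    moreover have "b \<otimes> a \<in> sn (\<Union>\<C>)" if "b \<in> fs (\<Union>\<C>)" "a \<in> sn (\<Union>\<C>)" for a b
    proof -
      have "\<exists>S \<in> \<C>. Inl b \<in> S \<and> Inr a \<in> S"
        by (rule two) (use that in \<open>auto simp: sn_def fs_def\<close>)
      then obtain S where "S \<in> \<C>" "b \<in> fs S" "a \<in> sn S" by (auto simp: sn_def fs_def)
      then show ?thesis using D(9)[of S b a] by (auto simp: sn_def)
    qed
    ultimately have "proper_pair R (fs (\<Union>\<C>)) (sn (\<Union>\<C>))"
      by (auto simp: proper_pair_def)
    moreover have "A \<subseteq> fs (\<Union>\<C>)" "I \<subseteq> sn (\<Union>\<C>)"
      using CA[OF S0] S0 by (auto simp: \<A>_def fs_def sn_def)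
    ultimately show "\<Union>\<C> \<in> \<A>" by (simp add: \<A>_def)
  qed
  then obtain S where S: "S \<in> \<A>" "\<And>T. T \<in> \<A> \<Longrightarrow> S \<subseteq> T \<Longrightarrow> T = S" by blast
  have "maximal_pair (fs S) (sn S)"
    unfolding maximal_pair_def
  proof (intro conjI allI impI)
    show "proper_pair R (fs S) (sn S)" using S by (simp add: \<A>_def)
    fix B' J' assume *: "proper_pair R B' J'" "fs S \<subseteq> B'" "sn S \<subseteq> J'"
    then have "Sum_Type.Plus B' J' \<in> \<A>" using S(1) by (auto simp: \<A>_def enc)
    moreover have "S \<subseteq> Sum_Type.Plus B' J'"
    proof
      fix s assume "s \<in> S" then show "s \<in> Sum_Type.Plus B' J'"
        using * by (cases s) (auto simp: fs_def sn_def)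
    qed
    ultimately have "Sum_Type.Plus B' J' = S" by (rule S(2))
    then show "B' \<subseteq> fs S" using enc(1)[of B' J'] by simp
  qed
  then show thesis using that S(1) by (auto simp: \<A>_def)
qed

theorem chevalley_extension:
  assumes "proper_pair R A I"
  obtains W where "valuation_ring R W" "A \<subseteq> W" "I \<subseteq> nonunits R W"
  using exists_maximal_pair[OF assms] maximal_pair_valuation_ring by (metis subset_trans)


section \<open>Valuation rings of subfields\<close>

text \<open>A valuation ring of the subfield \<open>L\<close>, written with the inverse of the
  ambient field, so that rings belonging to different subfields can be compared inside one
  structure.\<close>

definition valuation_subring :: "'a set \<Rightarrow> 'a set \<Rightarrow> bool"
  where "valuation_subring L W \<longleftrightarrow> subring W R \<and> W \<subseteq> L \<and>
    (\<forall>x \<in> L - {\<zero>}. x \<in> W \<or> inv x \<in> W)"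

lemma subfield_inv_consistent:
  assumes "subfield L R" "x \<in> L" "x \<noteq> \<zero>"
  shows "inv\<^bsub>R\<lparr>carrier := L\<rparr>\<^esub> x = inv x"
proof -
  have "submonoid L R" using subfieldE(1)[OF assms(1)] by (rule subring.axioms)
  moreover have "x \<in> Units (R\<lparr>carrier := L\<rparr>)"
    using subfield.subfield_Units[OF assms(1)] assms by auto
  ultimately show ?thesis by (simp add: m_inv_monoid_consistent)
qed

lemma subring_of_subfield_iff:
  assumes "subfield L R"
  shows "subring W (R\<lparr>carrier := L\<rparr>) \<longleftrightarrow> subring W R \<and> W \<subseteq> L"
proof -
  interpret L: ring "R\<lparr>carrier := L\<rparr>" using subring_is_ring[OF subfieldE(1)[OF assms]] .
  have "W \<subseteq> L" if "subring W (R\<lparr>carrier := L\<rparr>)"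
    using subringE(1)[OF that] by simp
  moreover have "subring W (R\<lparr>carrier := L\<rparr>) \<longleftrightarrow> subring W R" if "W \<subseteq> L"
    using L.subring_iff[of W] subring_iff[of W] that subfieldE(3)[OF assms] by auto
  ultimately show ?thesis by blast
qed

lemma valuation_ring_of_subfield_iff:
  assumes "subfield L R"
  shows "valuation_ring (R\<lparr>carrier := L\<rparr>) W \<longleftrightarrow> valuation_subring L W"
  unfolding valuation_ring_def valuation_subring_def subring_of_subfield_iff[OF assms]
  using subfield_inv_consistent[OF assms] by auto

lemma nonunits_of_subfield:
  assumes "subfield L R" "W \<subseteq> L"
  shows "nonunits (R\<lparr>carrier := L\<rparr>) W = nonunits R W"
  using subfield_inv_consistent[OF assms(1)] assms(2) by (auto simp: nonunits_def)

lemma chevalley_extension_in_subfield: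
  assumes L: "subfield L R" and P: "proper_pair R A I" and "A \<subseteq> L"
  obtains W where "valuation_subring L W" "A \<subseteq> W" "I \<subseteq> nonunits R W"
proof -
  interpret L: field "R\<lparr>carrier := L\<rparr>" using subfield_iff(2)[OF L] .
  have "proper_pair (R\<lparr>carrier := L\<rparr>) A I"
    using P assms(3) by (simp add: proper_pair_def subring_of_subfield_iff[OF L])
  from L.chevalley_extension[OF this] obtain W where
    W: "valuation_ring (R\<lparr>carrier := L\<rparr>) W" "A \<subseteq> W" "I \<subseteq> nonunits (R\<lparr>carrier := L\<rparr>) W" .
  have "valuation_subring L W" using W(1) valuation_ring_of_subfield_iff[OF L] by simp
  moreover from this have "nonunits (R\<lparr>carrier := L\<rparr>) W = nonunits R W"
    by (intro nonunits_of_subfield[OF L]) (simp add: valuation_subring_def)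
  ultimately show thesis using that W by auto
qed

lemma valuation_subringD:
  assumes "valuation_subring L W"
  shows "subring W R" "W \<subseteq> L" "W \<subseteq> carrier R" "\<zero> \<in> W" "\<one> \<in> W"
    and "\<And>x. x \<in> L \<Longrightarrow> x \<noteq> \<zero> \<Longrightarrow> x \<in> W \<or> inv x \<in> W"
    and "\<And>x y. x \<in> W \<Longrightarrow> y \<in> W \<Longrightarrow> x \<otimes> y \<in> W"
    and "\<And>x y. x \<in> W \<Longrightarrow> y \<in> W \<Longrightarrow> x \<oplus> y \<in> W"
    and "\<And>x. x \<in> W \<Longrightarrow> \<ominus> x \<in> W"
  using assms subringE[of W R] by (simp_all add: valuation_subring_def)

lemma inv_field:
  assumes "x \<in> carrier R" "x \<noteq> \<zero>"
  shows "inv x \<in> carrier R" "inv x \<noteq> \<zero>" "inv (inv x) = x" "x \<otimes> inv x = \<one>"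
proof -
  have u: "x \<in> Units R" using assms by (simp add: field_Units)
  then show "inv x \<in> carrier R" "inv (inv x) = x" "x \<otimes> inv x = \<one>" by simp_all
  have "inv x \<in> Units R" using u by simp
  then show "inv x \<noteq> \<zero>" by (simp add: field_Units)
qed

lemma inv_mult_field:
  assumes "x \<in> carrier R" "x \<noteq> \<zero>" "y \<in> carrier R" "y \<noteq> \<zero>"
  shows "inv (x \<otimes> y) = inv x \<otimes> inv y"
proof -
  have c: "inv x \<in> carrier R" "inv y \<in> carrier R" "x \<otimes> inv x = \<one>" "y \<otimes> inv y = \<one>"
    using assms by (auto simp: field_Units)
  have "(x \<otimes> y) \<otimes> (inv x \<otimes> inv y) = (x \<otimes> inv x) \<otimes> (y \<otimes> inv y)"
    using c(1,2) assms by algebra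
  then have "(x \<otimes> y) \<otimes> (inv x \<otimes> inv y) = \<one>" using c by simp
  then show ?thesis using c assms by (intro comm_inv_char) auto
qed

lemma nonunits_times:
  assumes W: "subring W R" and b: "b \<in> W" and a: "a \<in> nonunits R W"
  shows "b \<otimes> a \<in> nonunits R W"
proof -
  note E = subringE[OF W]
  have aW: "a \<in> W" using a by (simp add: nonunits_def)
  have c: "a \<in> carrier R" "b \<in> carrier R" using aW b E(1) by auto
  have "b \<otimes> a \<in> W" using E b aW by auto
  moreover have False if n: "b \<otimes> a \<noteq> \<zero>" and i: "inv (b \<otimes> a) \<in> W"
  proof -
    have nz: "a \<noteq> \<zero>" "b \<noteq> \<zero>" using n c by auto
    have ic: "inv a \<in> carrier R" "inv b \<in> carrier R" "b \<otimes> inv b = \<one>" "a \<otimes> inv a = \<one>"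
      using nz c by (auto simp: field_Units)
    have "b \<otimes> inv (b \<otimes> a) = (b \<otimes> inv b) \<otimes> inv a"
      using c nz ic(1,2) by (simp add: inv_mult_field m_assoc)
    then have "inv a = b \<otimes> inv (b \<otimes> a)" using ic by simp
    then have "inv a \<in> W" using E(6)[OF b i] by simp
    then show False using a nz by (simp add: nonunits_def)
  qed
  ultimately show ?thesis by (auto simp: nonunits_def)
qed

lemma one_not_nonunit:
  assumes "subring W R"
  shows "\<one> \<notin> nonunits R W"
  using subringE(3)[OF assms] by (auto simp: nonunits_def)

section \<open>The maximal ideal, domination and existence of prolongations\<close>

text \<open>For nonzero nonunits \<open>x\<close> and \<open>y\<close> one of \<open>x/y\<close> and
  \<open>y/x\<close> lies in \<open>W\<close>. In the first case \<open>x + y = (x/y + 1) y\<close>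
  is a multiple of a nonunit; the second is symmetric.\<close>

lemma valuation_subring_proper_pair:
  assumes L: "subfield L R" and W: "valuation_subring L W"
  shows "proper_pair R W (nonunits R W)"
proof -
  note D = valuation_subringD[OF W]
  have Wc: "nonunits R W \<subseteq> W" by (auto simp: nonunits_def)
  have add: "x \<oplus> y \<in> nonunits R W"
    if x: "x \<in> nonunits R W" and y: "y \<in> nonunits R W" and q: "inv y \<otimes> x \<in> W" and "y \<noteq> \<zero>" for x y
  proof -
    have c: "x \<in> carrier R" "y \<in> carrier R" using x y Wc D(3) by auto
    have ic: "inv y \<in> carrier R" "y \<otimes> inv y = \<one>" using c that by (auto simp: field_Units)
    have "(inv y \<otimes> x \<oplus> \<one>) \<otimes> y = (y \<otimes> inv y) \<otimes> x \<oplus> y" using c ic(1) by algebra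
    then have "(inv y \<otimes> x \<oplus> \<one>) \<otimes> y = x \<oplus> y" using c ic by simp
    moreover have "inv y \<otimes> x \<oplus> \<one> \<in> W" using D q by auto
    ultimately show ?thesis using nonunits_times[OF D(1) _ y] by metis
  qed
  have "x \<oplus> y \<in> nonunits R W" if x: "x \<in> nonunits R W" and y: "y \<in> nonunits R W" for x y
  proof (cases "x = \<zero> \<or> y = \<zero>")
    case True
    then show ?thesis using x y Wc D(3) by auto
  next
    case False
    have xyL: "x \<in> L" "y \<in> L" using x y Wc D(2) by auto
    have c: "x \<in> carrier R" "y \<in> carrier R" using x y Wc D(3) by auto
    have ic: "inv y \<in> carrier R" "inv x \<in> carrier R" "inv (inv y) = y" "inv y \<noteq> \<zero>" "inv x \<noteq> \<zero>"
      using inv_field c False by auto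
    have "inv y \<otimes> x \<in> L"
      using subringE(6)[OF subfieldE(1)[OF L]] subfield_m_inv(1)[OF L] xyL False by auto
    moreover have "inv y \<otimes> x \<noteq> \<zero>" using c ic False integral_iff by simp
    moreover have "inv (inv y \<otimes> x) = inv x \<otimes> y"
      using c ic False m_comm by (simp add: inv_mult_field)
    ultimately have "inv y \<otimes> x \<in> W \<or> inv x \<otimes> y \<in> W" using D(6) by metis
    then show ?thesis using add[OF x y] add[OF y x] False c a_comm by metis
  qed
  then show ?thesis
    unfolding proper_pair_def
    using D(1) D(4) Wc nonunits_times[OF D(1)] one_not_nonunit[OF D(1)]
    by (simp add: nonunits_def[of R W])
qed

lemma not_in_valuation_subring:
  assumes W: "valuation_subring L W" and x: "x \<in> L" "x \<in> carrier R" "x \<notin> W"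
  shows "x \<noteq> \<zero>" "inv x \<noteq> \<zero>" "inv (inv x) = x" "inv x \<in> nonunits R W"
proof -
  note D = valuation_subringD[OF W]
  show nz: "x \<noteq> \<zero>" using D x by auto
  then show "inv x \<noteq> \<zero>" "inv (inv x) = x"
    using inv_field[OF x(2)] by auto
  then show "inv x \<in> nonunits R W" using D(6)[OF x(1) nz] x by (auto simp: nonunits_def)
qed

text \<open>For \<open>x\<close> in \<open>k\<close> outside \<open>V\<close> the inverse is a
  nonunit of \<open>V\<close>, hence of \<open>W\<close>, and so \<open>x\<close> is not in
  \<open>W\<close>.\<close>

lemma dominating_imp_prolongation:
  assumes k: "subfield k R" and "valuation_subring k V" "V \<subseteq> W" "nonunits R V \<subseteq> nonunits R W"
  shows "W \<inter> k = V"
proof -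
  have "x \<in> V" if x: "x \<in> W" "x \<in> k" for x
  proof (rule ccontr)
    assume "x \<notin> V"
    moreover have "x \<in> carrier R" using x subfieldE(3)[OF k] by auto
    ultimately have "inv x \<noteq> \<zero>" "inv (inv x) = x" "inv x \<in> nonunits R W"
      using not_in_valuation_subring[OF assms(2) x(2)] assms(4) by auto
    then show False using x by (simp add: nonunits_def)
  qed
  then show ?thesis using assms valuation_subringD(2)[OF assms(2)] by auto
qed

lemma exists_prolongation:
  assumes "subfield L R" "subfield k R" "k \<subseteq> L" "valuation_subring k V"
  obtains W where "valuation_subring L W" "W \<inter> k = V"
proof -
  obtain W where "valuation_subring L W" "V \<subseteq> W" "nonunits R V \<subseteq> nonunits R W"
    using chevalley_extension_in_subfield[OF assms(1) valuation_subring_proper_pair[OF assms(2,4)]]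
      valuation_subringD(2)[OF assms(4)] assms(3) by auto
  then show thesis using dominating_imp_prolongation[OF assms(2,4)] that by auto
qed

lemma one_plus_nonunit:
  assumes L: "subfield L R" and W: "valuation_subring L W" and a: "a \<in> nonunits R W"
  shows "\<one> \<oplus> a \<in> W - nonunits R W"
proof -
  note P = proper_pairD[OF valuation_subring_proper_pair[OF L W]]
  have c: "a \<in> carrier R" "a \<in> W" using a P by auto
  have "\<one> \<oplus> a \<oplus> \<ominus> a = \<one>" using c(1) by algebra
  then have "\<one> \<oplus> a \<notin> nonunits R W" using P(8)[OF _ P(11)[OF a], of "\<one> \<oplus> a"] P(5) by auto
  then show ?thesis using valuation_subringD(5,8)[OF W] c by auto
qed

text \<open>Chevalley's theorem is applied to \<open>A = V + m\<close> and \<open>I = n + m\<close>,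
  where \<open>m\<close> and \<open>n\<close> are the maximal ideals of \<open>W\<close> and
  \<open>V\<close>. Here \<open>A\<close> is the preimage in \<open>W\<close> of the image of
  \<open>V\<close> in the residue field of \<open>W\<close>. The summand \<open>n\<close> of
  \<open>I\<close> forces the trace \<open>V\<close> on \<open>k\<close>, the summand
  \<open>m\<close> forces \<open>U \<subseteq> W\<close>.\<close>

lemma exists_finer_prolongation:
  assumes L: "subfield L R" and k: "subfield k R" and kL: "k \<subseteq> L"
    and V: "valuation_subring k V" and W: "valuation_subring L W" and VW: "V \<subseteq> W"
  obtains U where "valuation_subring L U" "U \<inter> k = V" "U \<subseteq> W"
proof -
  note DV = valuation_subringD[OF V] and DW = valuation_subringD[OF W]
  note PV = proper_pairD[OF valuation_subring_proper_pair[OF k V]]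
  note PW = proper_pairD[OF valuation_subring_proper_pair[OF L W]]
  let ?m = "nonunits R W" and ?n = "nonunits R V"
  define A where "A = {v \<oplus> m | v m. v \<in> V \<and> m \<in> ?m}"
  define I where "I = {v \<oplus> m | v m. v \<in> ?n \<and> m \<in> ?m}"
  have carr: "v \<in> carrier R" "m \<in> carrier R" if "v \<in> V" "m \<in> ?m" for v m
    using that DV(3) PW(6) by auto
  have AW: "A \<subseteq> W" using VW PW(3) DW(8) unfolding A_def by blast
  \<comment> \<open>Splits a product into a part from \<open>V\<close> and a part from
    \<open>m\<close>; it serves both for closure of \<open>A\<close> and for \<open>I\<close>
    absorbing \<open>A\<close>.\<close>
  have Am: "(v \<oplus> m) \<otimes> (v' \<oplus> m') = v \<otimes> v' \<oplus> (v \<otimes> m' \<oplus> (v' \<oplus> m') \<otimes> m) \<and>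
      v \<otimes> m' \<oplus> (v' \<oplus> m') \<otimes> m \<in> ?m"
    if "v \<in> V" "m \<in> ?m" "v' \<in> V" "m' \<in> ?m" for v m v' m'
  proof
    show "(v \<oplus> m) \<otimes> (v' \<oplus> m') = v \<otimes> v' \<oplus> (v \<otimes> m' \<oplus> (v' \<oplus> m') \<otimes> m)"
      using carr[OF that(1,2)] carr[OF that(3,4)] by algebra
    have "v' \<oplus> m' \<in> W" using that VW PW(3) DW(8) by blast
    then show "v \<otimes> m' \<oplus> (v' \<oplus> m') \<otimes> m \<in> ?m"
      using that VW by (intro PW(8,9)) auto
  qed
  have Aa: "(v \<oplus> m) \<oplus> (v' \<oplus> m') = (v \<oplus> v') \<oplus> (m \<oplus> m')"
    if "v \<in> V" "m \<in> ?m" "v' \<in> V" "m' \<in> ?m" for v m v' m'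
    using carr[OF that(1,2)] carr[OF that(3,4)] by algebra
  have VA: "V \<subseteq> A" and nI: "?n \<subseteq> I" and mI: "?m \<subseteq> I"
  proof -
    have "v = v \<oplus> \<zero>" if "v \<in> V" for v using that DV(3) by auto
    then show "V \<subseteq> A" "?n \<subseteq> I" unfolding A_def I_def using PW(4) PV(3) by blast+
    have "m = \<zero> \<oplus> m" if "m \<in> ?m" for m using that PW(6) by auto
    then show "?m \<subseteq> I" unfolding I_def using PV(4) by blast
  qed
  have "subring A R"
  proof (rule subringI)
    show "A \<subseteq> carrier R" using AW DW(3) by blast
    show "\<one> \<in> A" using VA DV(5) by blast
  next
    fix h assume "h \<in> A"
    then obtain v m where h: "h = v \<oplus> m" "v \<in> V" "m \<in> ?m" unfolding A_def by blast
    then have "\<ominus> h = \<ominus> v \<oplus> \<ominus> m" using carr[OF h(2,3)] by algebra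
    then show "\<ominus> h \<in> A" unfolding A_def using DV(9)[OF h(2)] PW(11)[OF h(3)] by blast
  next
    fix h1 h2 assume "h1 \<in> A" "h2 \<in> A"
    then obtain v m v' m' where h: "h1 = v \<oplus> m" "v \<in> V" "m \<in> ?m" "h2 = v' \<oplus> m'" "v' \<in> V" "m' \<in> ?m"
      unfolding A_def by blast
    show "h1 \<otimes> h2 \<in> A"
      using Am[OF h(2,3,5,6)] DV(7)[OF h(2,5)] unfolding h(1,4) by (auto simp: A_def)
    show "h1 \<oplus> h2 \<in> A"
      using Aa[OF h(2,3,5,6)] DV(8)[OF h(2,5)] PW(8)[OF h(3,6)] unfolding h(1,4) by (auto simp: A_def)
  qed
  moreover have "I \<subseteq> A" unfolding A_def I_def using PV(3) by blast
  moreover have "\<zero> \<in> I" using nI PV(4) by blast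
  \<comment> \<open>If \<open>1 = v + m\<close>, then \<open>m = 1 - v\<close> is a unit of
    \<open>V\<close>, hence of \<open>W\<close>, although it is a nonunit of
    \<open>W\<close>.\<close>
  moreover have "\<one> \<notin> I"
  proof
    assume "\<one> \<in> I"
    then obtain v m where e: "\<one> = v \<oplus> m" "v \<in> ?n" "m \<in> ?m" unfolding I_def by blast
    have vV: "v \<in> V" using e PV(3) by blast
    have "m = (v \<oplus> m) \<oplus> \<ominus> v" using carr[OF vV e(3)] by algebra
    then have m: "m = \<one> \<oplus> \<ominus> v" using e(1) by simp
    then have "m \<in> V - ?n" using one_plus_nonunit[OF k V PV(11)[OF e(2)]] by simp
    then have "m \<noteq> \<zero>" "inv m \<in> W" using VW by (auto simp: nonunits_def)
    then show False using e(3) by (simp add: nonunits_def)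
  qed
  moreover have "a \<oplus> b \<in> I" if ab: "a \<in> I" "b \<in> I" for a b
  proof -
    obtain v m v' m' where h: "a = v \<oplus> m" "v \<in> ?n" "m \<in> ?m" "b = v' \<oplus> m'" "v' \<in> ?n" "m' \<in> ?m"
      using ab unfolding I_def by blast
    have "v \<in> V" "v' \<in> V" using h PV(3) by auto
    then show ?thesis
      using Aa[of v m v' m'] PV(8)[OF h(2,5)] PW(8)[OF h(3,6)] h(3,6) unfolding h(1,4) by (auto simp: I_def)
  qed
  moreover have "b \<otimes> a \<in> I" if ab: "b \<in> A" "a \<in> I" for a b
  proof -
    obtain v m v' m' where h: "b = v \<oplus> m" "v \<in> V" "m \<in> ?m" "a = v' \<oplus> m'" "v' \<in> ?n" "m' \<in> ?m"
      using ab unfolding I_def A_def by blast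
    have "v' \<in> V" using h PV(3) by auto
    then show ?thesis
      using Am[of v m v' m'] PV(9)[OF h(2,5)] h(2,3,6) unfolding h(1,4) by (auto simp: I_def)
  qed
  ultimately have "proper_pair R A I" by (auto simp: proper_pair_def)
  then obtain U where U: "valuation_subring L U" "A \<subseteq> U" "I \<subseteq> nonunits R U"
    using chevalley_extension_in_subfield[OF L, of A I] AW DW(2) by blast
  have "U \<inter> k = V"
    using dominating_imp_prolongation[OF k V, of U] U VA nI by blast
  \<comment> \<open>An element of \<open>U\<close> outside \<open>W\<close> has its inverse in the
    maximal ideal of \<open>W\<close>, which lies in that of \<open>U\<close>.\<close>
  moreover have "U \<subseteq> W"
  proof
    fix x assume x: "x \<in> U"
    show "x \<in> W"
    proof (rule ccontr)
      assume nW: "x \<notin> W"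
      have "x \<in> L" "x \<in> carrier R" using x valuation_subringD[OF U(1)] by auto
      then have "inv x \<in> ?m" "inv x \<noteq> \<zero>" "inv (inv x) = x"
        using not_in_valuation_subring[OF W _ _ nW] by auto
      moreover from this have "inv x \<in> nonunits R U" using mI U by auto
      ultimately show False using x by (simp add: nonunits_def)
    qed
  qed
  ultimately show thesis using that U by blast
qed

lemma valuation_ring_iff_valuation_subring:
  "valuation_ring R V \<longleftrightarrow> valuation_subring (carrier R) V"
  using subringE(1)[of V R] by (auto simp: valuation_ring_def valuation_subring_def)

text \<open>Lets statements about a field be applied to the residue field. The nonunits form an
  ideal, and a larger ideal contains a unit, so the ideal is maximal.\<close>

lemma residue_field_is_field:
  assumes "valuation_ring R V"
  shows "field (residue_field R V)"
proof -
  have V: "valuation_subring (carrier R) V"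
    using assms by (simp add: valuation_ring_iff_valuation_subring)
  note D = valuation_subringD[OF V]
  note P = proper_pairD[OF valuation_subring_proper_pair[OF carrier_is_subfield V]]
  let ?V = "R\<lparr>carrier := V\<rparr>" and ?m = "nonunits R V"
  interpret V: domain ?V using subring_is_domain[OF D(1)] .
  \<comment> \<open>Reconciles \<open>Units\<close> of the substructure, which occurs in
    \<open>residue_field\<close>, with \<open>nonunits\<close>, which refers to the ambient
    inverse.\<close>
  have units: "x \<in> Units ?V \<longleftrightarrow> x \<notin> ?m" if x: "x \<in> V" for x
  proof
    assume u: "x \<in> Units ?V"
    then obtain y where "y \<in> V" "y \<otimes> x = \<one>" by (auto simp: Units_def)
    then show "x \<notin> ?m" using P(5,9) by metis
  next
    assume "x \<notin> ?m"
    then have i: "x \<noteq> \<zero>" "inv x \<in> V" using x by (auto simp: nonunits_def)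
    moreover have "x \<in> carrier R" using x D(3) by auto
    ultimately have "x \<otimes> inv x = \<one>" "inv x \<otimes> x = \<one>" by (auto simp: field_Units)
    then show "x \<in> Units ?V" using x i by (auto simp: Units_def)
  qed
  then have m: "V - Units ?V = ?m" using P(3) by auto
  have "ideal ?m ?V"
  proof (rule idealI)
    show "ring ?V" by (rule V.ring_axioms)
    show "subgroup ?m (add_monoid ?V)"
    proof (rule V.add.subgroupI)
      fix a assume a: "a \<in> ?m"
      then have aV: "a \<in> carrier ?V" using P(3) by auto
      have "\<ominus>\<^bsub>?V\<^esub> a = \<ominus>\<^bsub>?V\<^esub> \<one>\<^bsub>?V\<^esub> \<otimes>\<^bsub>?V\<^esub> a"
        using V.l_minus[OF V.one_closed aV] V.l_one[OF aV] by simp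
      moreover have "\<ominus>\<^bsub>?V\<^esub> \<one>\<^bsub>?V\<^esub> \<in> V" using V.a_inv_closed[OF V.one_closed] by simp
      ultimately show "\<ominus>\<^bsub>?V\<^esub> a \<in> ?m" using P(9)[OF _ a] by simp
    qed (use P in auto)
  qed (use P in auto)
  moreover have "V \<noteq> ?m" using D(5) P(5) by blast
  moreover have "J = ?m \<or> J = V" if J: "ideal J ?V" "?m \<subseteq> J" "J \<subseteq> V" for J
  proof (cases "J = ?m")
    case False
    then obtain x where x: "x \<in> J" "x \<notin> ?m" using J(2) by blast
    then have "x \<in> Units ?V" using units J(3) by blast
    then have "J = carrier ?V" using ideal.I_l_closed[OF J(1) x(1)]
      by (metis V.Units_l_inv V.Units_inv_closed V.cring_axioms ideal.one_imp_carrier J(1))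
    then show ?thesis by simp
  qed simp
  ultimately have "maximalideal ?m ?V" by (intro maximalidealI) auto
  from maximalideal.quotient_is_field[OF this V.cring_axioms]
  show ?thesis by (simp add: residue_field_def m)
qed


section \<open>Prolongations to algebraic extensions\<close>

lemma units_mult:
  assumes W: "subring W R" and u: "u \<in> W - nonunits R W" and v: "v \<in> W - nonunits R W"
  shows "u \<otimes> v \<in> W - nonunits R W"
proof -
  note E = subringE[OF W]
  have "u \<in> carrier R" "u \<noteq> \<zero>" "inv u \<in> W" "v \<in> carrier R" "v \<noteq> \<zero>" "inv v \<in> W"
    using u v E(1) by (auto simp: nonunits_def)
  moreover from this have "inv (u \<otimes> v) \<in> W" "u \<otimes> v \<noteq> \<zero>"
    using E(6) integral_iff by (auto simp: inv_mult_field)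
  ultimately show ?thesis using E(6) u v by (auto simp: nonunits_def)
qed

text \<open>If no two terms of \<open>p(x)\<close> agree up to a unit of \<open>W\<close> then one of them dominates the others, and
  \<open>p(x)\<close> is a unit multiple of it; in particular \<open>p(x) \<noteq> 0\<close>.\<close>

lemma eval_dominated_by_term:
  assumes L: "subfield L R" and k: "subfield k R" "k \<subseteq> L" and W: "valuation_subring L W"
    and x: "x \<in> L" "x \<noteq> \<zero>"
    and indep: "\<And>n c. n > 0 \<Longrightarrow> c \<in> k \<Longrightarrow> c \<noteq> \<zero> \<Longrightarrow> x [^] (n::nat) \<otimes> c \<notin> W - nonunits R W"
    and "set p \<subseteq> k" and "\<exists>a \<in> set p. a \<noteq> \<zero>"
  shows "\<exists>u c i. u \<in> W - nonunits R W \<and> c \<in> k \<and> c \<noteq> \<zero> \<and> i < length p \<and>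
    eval p x = u \<otimes> (c \<otimes> x [^] i)"
  using assms(8,9)
proof (induct p)
  case Nil
  then show ?case by simp
next
  case (Cons a p)
  note P = proper_pairD[OF valuation_subring_proper_pair[OF L W]]
  note D = valuation_subringD[OF W]
  let ?U = "W - nonunits R W"
  define n where "n = length p"
  have xc: "x \<in> carrier R" using x subfieldE(3)[OF L] by auto
  have kc: "k \<subseteq> carrier R" using subfieldE(3)[OF k(1)] .
  have pow: "x [^] i \<in> carrier R" "x [^] i \<noteq> \<zero>" "x [^] i \<in> L" for i :: nat
  proof -
    show "x [^] i \<in> carrier R" using xc by simp
    show "x [^] i \<noteq> \<zero>" using xc x(2) by (induct i) (auto simp: integral_iff)
    show "x [^] i \<in> L"
      using x(1) subringE(3,6)[OF subfieldE(1)[OF L]] by (induct i) auto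
  qed
  have a: "a \<in> k" "a \<in> carrier R" using Cons(2) kc by auto
  have ev: "eval (a # p) x = a \<otimes> x [^] n \<oplus> eval p x" by (simp add: n_def)
  have one: "\<one> \<in> ?U" using D(5) P(5) by auto
  have zeros: "eval p x = \<zero>" if "\<forall>b \<in> set p. b = \<zero>"
    using that pow(1) by (induct p) auto
  show ?case
  proof (cases "\<exists>b \<in> set p. b \<noteq> \<zero>")
    case False
    then have "a \<noteq> \<zero>" using Cons(3) by auto
    moreover have "eval (a # p) x = \<one> \<otimes> (a \<otimes> x [^] n)"
      unfolding ev using zeros False a pow(1) by auto
    ultimately show ?thesis using one a(1) n_def by (metis length_Cons lessI)
  next
    case True
    then obtain u c i where u: "u \<in> ?U" and c: "c \<in> k" "c \<noteq> \<zero>" and i: "i < n"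
      and e: "eval p x = u \<otimes> (c \<otimes> x [^] i)"
      using Cons(1,2) n_def by auto
    have uc: "u \<in> carrier R" "u \<noteq> \<zero>" "inv u \<in> W" using u D(3) by (auto simp: nonunits_def)
    have cc: "c \<in> carrier R" using c kc by auto
    show ?thesis
    proof (cases "a = \<zero>")
      case True
      then have "eval (a # p) x = u \<otimes> (c \<otimes> x [^] i)"
        unfolding ev e using pow(1) uc cc by simp
      then show ?thesis using u c i n_def by (metis length_Cons less_SucI)
    next
      case False
      let ?s = "a \<otimes> x [^] n" and ?e = "u \<otimes> (c \<otimes> x [^] i)"
      \<comment> \<open>The quotient of the new leading term by the value of the remaining
        polynomial. Whether \<open>q\<close> or its inverse is a nonunit, or \<open>q\<close> is a
        unit, decides which term dominates.\<close>
      define q where "q = ?s \<otimes> inv ?e"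
      have ec: "?e \<in> carrier R" "?e \<noteq> \<zero>" using uc cc c pow integral_iff by auto
      have sc: "?s \<in> carrier R" "?s \<noteq> \<zero>" using a False pow integral_iff by auto
      have Lc: "?s \<in> L" "?e \<in> L"
        using subringE(6)[OF subfieldE(1)[OF L]] subsetD[OF k(2) a(1)] subsetD[OF k(2) c(1)]
          subsetD[OF D(2), of u] u pow(3) by auto
      note ie = inv_field[OF ec]
      have qc: "q \<in> carrier R" "q \<noteq> \<zero>" unfolding q_def using sc ie integral_iff by auto
      have qL: "q \<in> L"
        unfolding q_def using subringE(6)[OF subfieldE(1)[OF L]] Lc subfield_m_inv(1)[OF L, of ?e] ec
        by auto
      have sqe: "?s = q \<otimes> ?e"
      proof -
        have "q \<otimes> ?e = ?s \<otimes> (?e \<otimes> inv ?e)" unfolding q_def using sc(1) ec(1) ie(1) by algebra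
        then show ?thesis using ie sc by simp
      qed
      consider "q \<in> nonunits R W" | "inv q \<in> nonunits R W" | "q \<in> ?U"
        using not_in_valuation_subring[OF W qL qc(1)] by blast
      then show ?thesis
      proof cases
        case 1
        have "?s \<oplus> ?e = ((\<one> \<oplus> q) \<otimes> u) \<otimes> (c \<otimes> x [^] i)"
          unfolding sqe using qc(1) uc(1) cc pow(1)[of i] by algebra
        moreover have "(\<one> \<oplus> q) \<otimes> u \<in> ?U"
          using units_mult[OF D(1) one_plus_nonunit[OF L W 1] u] .
        ultimately show ?thesis using c i n_def unfolding ev e by (metis length_Cons less_SucI)
      next
        case 2
        have "inv q \<otimes> ?s = (q \<otimes> inv q) \<otimes> ?e" 
          unfolding sqe using inv_field(1)[OF qc] qc(1) uc(1) cc pow(1)[of i] by algebra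
        then have "inv q \<otimes> ?s = ?e" using inv_field(4)[OF qc] ec(1) by simp
        then have "?s \<oplus> ?e = ?s \<oplus> inv q \<otimes> ?s" by simp
        also have "\<dots> = (\<one> \<oplus> inv q) \<otimes> ?s"
          using sc(1) inv_field(1)[OF qc] by algebra
        finally have "eval (a # p) x = (\<one> \<oplus> inv q) \<otimes> (a \<otimes> x [^] n)" unfolding ev e .
        then show ?thesis using one_plus_nonunit[OF L W 2] a(1) False n_def
          by (metis length_Cons lessI)
      next
        \<comment> \<open>Both terms agree up to a unit. Cancelling \<open>x^i\<close> makes
          \<open>x^(n - i) a/c\<close> a unit of \<open>W\<close>; since \<open>i < n\<close>, the
          exponent is positive and \<open>indep\<close> excludes this.\<close>
        case 3
        have ic: "inv c \<in> k" "inv c \<in> carrier R" "c \<otimes> inv c = \<one>" "inv c \<noteq> \<zero>"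
          using subfield_m_inv[OF k(1), of c] c kc by auto
        have ia: "inv a \<in> k" "inv a \<in> carrier R" "a \<otimes> inv a = \<one>" "inv a \<noteq> \<zero>"
          using subfield_m_inv[OF k(1), of a] a False kc by auto
        have "x [^] (n - i) \<otimes> x [^] i = x [^] n" using xc i by (simp add: nat_pow_mult)
        then have *: "a \<otimes> (x [^] (n - i) \<otimes> x [^] i) = q \<otimes> (u \<otimes> (c \<otimes> x [^] i))" using sqe by simp
        let ?d = "a \<otimes> inv c"
        have "(x [^] (n - i) \<otimes> ?d) \<otimes> x [^] i = (a \<otimes> (x [^] (n - i) \<otimes> x [^] i)) \<otimes> inv c"
          using pow(1)[of i] pow(1)[of "n-i"] a ic(2) by algebra
        also have "\<dots> = (q \<otimes> u \<otimes> (c \<otimes> inv c)) \<otimes> x [^] i"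
          unfolding * using pow(1)[of i] qc(1) uc(1) cc ic(2) by algebra
        finally have "(x [^] (n - i) \<otimes> ?d) \<otimes> x [^] i = (q \<otimes> u) \<otimes> x [^] i"
          using ic qc uc by simp
        then have "x [^] (n - i) \<otimes> ?d = q \<otimes> u"
          using m_rcancel[OF pow(2)[of i] pow(1)[of i]] pow(1) a ic(2) qc uc by simp
        moreover have "q \<otimes> u \<in> ?U" using units_mult[OF D(1) 3 u] .
        moreover have "?d \<in> k" "?d \<noteq> \<zero>" 
          using subringE(6)[OF subfieldE(1)[OF k(1)]] a ic False integral_iff by auto
        ultimately show ?thesis using indep[of "n - i" ?d] i by auto
      qed
    qed
  qed
qed

text \<open>For \<open>x\<close> in \<open>W2\<close> outside \<open>W1\<close>, no
  \<open>x^m c\<close> with \<open>m > 0\<close> and nonzero \<open>c\<close> in \<open>k\<close> is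
  a unit of \<open>W1\<close>. Then one term dominates in every nonzero polynomial over
  \<open>k\<close> evaluated at \<open>x\<close>, so none vanishes there, against
  algebraicity.\<close>

lemma prolongation_antimono:
  assumes L: "subfield L R" and k: "subfield k R" "k \<subseteq> L"
    and alg: "\<And>x. x \<in> L \<Longrightarrow> (algebraic over k) x"
    and W1: "valuation_subring L W1" and W2: "valuation_subring L W2"
    and eq: "W1 \<inter> k = W2 \<inter> k" and sub: "W1 \<subseteq> W2"
  shows "W2 \<subseteq> W1"
proof
  fix x assume x2: "x \<in> W2"
  note D1 = valuation_subringD[OF W1] and D2 = valuation_subringD[OF W2]
  note P1 = proper_pairD[OF valuation_subring_proper_pair[OF L W1]]
  show "x \<in> W1"
  proof (rule ccontr)
    assume n: "x \<notin> W1"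
    have xL: "x \<in> L" "x \<in> carrier R" using x2 D2 by auto
    note N = not_in_valuation_subring[OF W1 xL n]
    have indep: "x [^] m \<otimes> c \<notin> W1 - nonunits R W1"
      if c: "m > 0" "c \<in> k" "c \<noteq> \<zero>" for m :: nat and c
    proof
      let ?u = "x [^] m \<otimes> c"
      assume u: "?u \<in> W1 - nonunits R W1"
      have cc: "c \<in> carrier R" "inv c \<in> k" "inv c \<in> carrier R" "c \<otimes> inv c = \<one>" "inv c \<noteq> \<zero>"
        using c subfieldE(3)[OF k(1)] subfield_m_inv[OF k(1), of c] by auto
      have uc: "?u \<in> W1" "?u \<in> carrier R" "?u \<noteq> \<zero>" "inv ?u \<in> W1"
        using u D1(3) by (auto simp: nonunits_def)
      have xm: "x [^] m \<in> carrier R" using xL by simp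
      have xm2: "x [^] m \<in> W2" using x2 D2(5,7) by (induct m) auto
      have "inv c \<otimes> (?u \<otimes> inv ?u) = (c \<otimes> inv c) \<otimes> (x [^] m \<otimes> inv ?u)"
        using cc(1,3) xm inv_field(1)[OF uc(2,3)] by algebra
      then have "inv c = x [^] m \<otimes> inv ?u"
        using inv_field[OF uc(2,3)] cc xm by simp
      \<comment> \<open>The equal traces on \<open>k\<close> carry \<open>1/c\<close> from
        \<open>W2\<close> to \<open>W1\<close>, and then \<open>x^m = u/c\<close> lies in
        \<open>W1\<close> as well.\<close>
      then have "inv c \<in> W2" using D2(7)[OF xm2, of "inv ?u"] uc(4) sub by auto
      then have ic: "inv c \<in> W1" using cc(2) eq by blast
      have "?u \<otimes> inv c = x [^] m \<otimes> (c \<otimes> inv c)" using cc(1,3) xm by algebra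
      then have "x [^] m = ?u \<otimes> inv c" using cc xm by simp
      then have xm1: "x [^] m \<in> W1" using D1(7)[OF uc(1) ic] by simp
      have inx: "inv x \<in> carrier R" "x \<otimes> inv x = \<one>" using inv_field[OF xL(2) N(1)] by auto
      \<comment> \<open>The induction effectively starts at exponent 1, since the power with
        exponent 0 is the unit 1.\<close>
      have "(inv x) [^] m \<in> nonunits R W1"
        using c(1)
      proof (induct m)
        case (Suc m)
        show ?case
        proof (cases "m = 0")
          case True
          then show ?thesis using N(4) inx by simp
        next
          case False
          then show ?thesis using Suc P1(9)[OF _ N(4)] P1(3) by auto
        qed
      qed simp
      then have "x [^] m \<otimes> (inv x) [^] m \<in> nonunits R W1" using P1(9)[OF xm1] by simp
      moreover have "x [^] m \<otimes> (inv x) [^] m = \<one>"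
        using inx xL by (simp add: nat_pow_distrib[symmetric])
      ultimately show False using P1(5) by simp
    qed
    obtain p where p: "p \<in> carrier (k[X])" "p \<noteq> []" "eval p x = \<zero>"
      using algebraicE[OF subfieldE(1)[OF k(1)] xL(2) alg[OF xL(1)]] .
    have "set p \<subseteq> k" "hd p \<noteq> \<zero>"
      using p(1,2) by (auto simp: univ_poly_def polynomial_def)
    moreover then have "\<exists>a \<in> set p. a \<noteq> \<zero>" using p(2) hd_in_set by blast
    ultimately obtain u c i where u: "u \<in> W1 - nonunits R W1" "c \<in> k" "c \<noteq> \<zero>"
      "eval p x = u \<otimes> (c \<otimes> x [^] (i::nat))"
      using eval_dominated_by_term[OF L k W1 xL(1) N(1) indep] by blast
    have "x [^] i \<noteq> \<zero>" using xL N(1) by (induct i) (auto simp: integral_iff)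
    moreover have "u \<in> carrier R" "u \<noteq> \<zero>" using u D1(3) by (auto simp: nonunits_def)
    moreover have "c \<in> carrier R" using u subfieldE(3)[OF k(1)] by auto
    ultimately have "eval p x \<noteq> \<zero>" using u(3,4) xL integral_iff by simp
    then show False using p(3) by simp
  qed
qed

section \<open>Comparable overrings and uniqueness for coarsenings\<close>

text \<open>Take \<open>x\<close> in \<open>W1\<close> only and \<open>y\<close> in
  \<open>W2\<close> only. If \<open>y/x\<close> is in \<open>U\<close>, then
  \<open>y = x (y/x)\<close> is in \<open>W1\<close>; otherwise \<open>x/y\<close> is in
  \<open>U\<close> and \<open>x = (x/y) y\<close> is in \<open>W2\<close>.\<close>

lemma overrings_comparable:
  assumes L: "subfield L R" and U: "valuation_subring L U"
    and W1: "valuation_subring L W1" "U \<subseteq> W1" and W2: "valuation_subring L W2" "U \<subseteq> W2"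
  shows "W1 \<subseteq> W2 \<or> W2 \<subseteq> W1"
proof (rule ccontr)
  assume "\<not> (W1 \<subseteq> W2 \<or> W2 \<subseteq> W1)"
  then obtain x y where xy: "x \<in> W1" "x \<notin> W2" "y \<in> W2" "y \<notin> W1" by blast
  note D1 = valuation_subringD[OF W1(1)] and D2 = valuation_subringD[OF W2(1)]
  have c: "x \<in> carrier R" "y \<in> carrier R" "x \<in> L" "y \<in> L" "x \<noteq> \<zero>" "y \<noteq> \<zero>"
    using xy D1 D2 by auto
  have ix: "inv x \<in> carrier R" "x \<otimes> inv x = \<one>" "inv x \<noteq> \<zero>" "inv (inv x) = x" "inv x \<in> L"
    using inv_field[OF c(1,5)] subfield_m_inv(1)[OF L, of x] c by auto
  have iy: "inv y \<in> carrier R" "y \<otimes> inv y = \<one>"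
    using inv_field[OF c(2,6)] by auto
  have "inv x \<otimes> y \<in> L" "inv x \<otimes> y \<noteq> \<zero>"
    using subringE(6)[OF subfieldE(1)[OF L]] ix c integral_iff by auto
  moreover have "inv (inv x \<otimes> y) = x \<otimes> inv y"
    using ix c by (simp add: inv_mult_field)
  ultimately consider "inv x \<otimes> y \<in> U" | "x \<otimes> inv y \<in> U"
    using valuation_subringD(6)[OF U, of "inv x \<otimes> y"] by auto
  then show False
  proof cases
    case 1
    then have "x \<otimes> (inv x \<otimes> y) \<in> W1" using xy(1) W1(2) D1(7) by blast
    moreover have "x \<otimes> (inv x \<otimes> y) = y" using c ix by (simp add: m_assoc[symmetric])
    ultimately show ?thesis using xy by simp
  next
    case 2
    then have "(x \<otimes> inv y) \<otimes> y \<in> W2" using xy(3) W2(2) D2(7) by blast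
    moreover have "(x \<otimes> inv y) \<otimes> y = x \<otimes> (y \<otimes> inv y)" using c iy(1) by algebra
    ultimately show ?thesis using xy iy c by simp
  qed
qed

theorem unique_prolongation_coarsening:
  assumes L: "subfield L R" and k: "subfield k R" "k \<subseteq> L"
    and alg: "\<And>x. x \<in> L \<Longrightarrow> (algebraic over k) x"
    and V: "valuation_subring k V" and V': "valuation_subring k V'" and VV': "V \<subseteq> V'"
    and uniq: "\<exists>!W. valuation_subring L W \<and> W \<inter> k = V"
  shows "\<exists>!W. valuation_subring L W \<and> W \<inter> k = V'"
proof (rule ex_ex1I)
  show "\<exists>W. valuation_subring L W \<and> W \<inter> k = V'"
    using exists_prolongation[OF L k V'] by metis
next
  fix W1 W2
  assume W: "valuation_subring L W1 \<and> W1 \<inter> k = V'" "valuation_subring L W2 \<and> W2 \<inter> k = V'"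
  then have s: "V \<subseteq> W1" "V \<subseteq> W2" using VV' by auto
  \<comment> \<open>The rings \<open>U1\<close> and \<open>U2\<close> both prolong \<open>V\<close>,
    so the uniqueness assumption identifies them and gives \<open>W1\<close> and \<open>W2\<close> a
    common valuation subring.\<close>
  obtain U1 where U1: "valuation_subring L U1" "U1 \<inter> k = V" "U1 \<subseteq> W1"
    using exists_finer_prolongation[OF L k V _ s(1)] W(1) by metis
  obtain U2 where U2: "valuation_subring L U2" "U2 \<inter> k = V" "U2 \<subseteq> W2"
    using exists_finer_prolongation[OF L k V _ s(2)] W(2) by metis
  have "U1 = U2" using uniq U1 U2 by blast
  then have "W1 \<subseteq> W2 \<or> W2 \<subseteq> W1"
    using overrings_comparable[OF L U1(1)] W U1(3) U2(3) by metis
  then show "W1 = W2"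
    using prolongation_antimono[OF L k alg] W by (metis subset_antisym)
qed

end


section \<open>Henselian valuations\<close>

context
  fixes F :: "('a, 'm) ring_scheme"
  assumes F: "field F"
begin

interpretation F: field F by (rule F)

interpretation Cl: algebraic_closure "field.alg_closure F" "base F"
  unfolding base_def by (rule F.alg_closureE)

interpretation Emb: ring_hom_ring F "field.alg_closure F" "emb F"
  using ring_hom_ringI2[OF F.ring_axioms Cl.ring_axioms F.alg_closureE(2)] .

lemma subfield_base: "subfield (base F) (field.alg_closure F)"
  by (rule Cl.subfield_axioms)

lemma valuation_subring_emb:
  assumes V: "valuation_ring F V"
  shows "field.valuation_subring (field.alg_closure F) (base F) (emb F ` V)"
  unfolding Cl.valuation_subring_def
proof (intro conjI ballI)
  have s: "subring V F" using V by (simp add: valuation_ring_def)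
  then show "subring (emb F ` V) (field.alg_closure F)" by (rule Emb.img_is_subring)
  show "emb F ` V \<subseteq> base F" using subringE(1)[OF s] by (auto simp: base_def)
  fix x assume "x \<in> base F - {\<zero>\<^bsub>field.alg_closure F\<^esub>}"
  then obtain a where a: "a \<in> carrier F" "x = emb F a" "x \<noteq> \<zero>\<^bsub>field.alg_closure F\<^esub>"
    by (auto simp: base_def)
  then have nz: "a \<noteq> \<zero>\<^bsub>F\<^esub>" using Emb.hom_zero by auto
  note i = F.inv_field[OF a(1) nz]
  have "x \<otimes>\<^bsub>field.alg_closure F\<^esub> emb F (inv\<^bsub>F\<^esub> a) = \<one>\<^bsub>field.alg_closure F\<^esub>"
    unfolding a(2) using Emb.hom_mult[OF a(1) i(1)] i(4) by simp
  then have "inv\<^bsub>field.alg_closure F\<^esub> x = emb F (inv\<^bsub>F\<^esub> a)"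
    using a(1,2) i(1) by (intro Cl.comm_inv_char) auto
  then show "x \<in> emb F ` V \<or> inv\<^bsub>field.alg_closure F\<^esub> x \<in> emb F ` V"
    using V a nz by (auto simp: valuation_ring_def)
qed

lemma henselian_coarsening:
  assumes V: "henselian F V" and W: "valuation_ring F W" and "V \<subseteq> W"
  shows "henselian F W"
  unfolding henselian_def
proof (intro conjI allI impI)
  show "valuation_ring F W" by (rule W)
  fix L assume ext: "algebraic_extension F L"
  then have L: "subfield L (field.alg_closure F)" "base F \<subseteq> L"
    by (simp_all add: algebraic_extension_def)
  \<comment> \<open>Restates prolongations as valuation subrings of the algebraic closure, the form
    in which uniqueness for coarsenings was proved.\<close>
  have prol: "prolongation F U L T \<longleftrightarrow>
      Cl.valuation_subring L T \<and> T \<inter> base F = emb F ` U" for U T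
    by (simp add: prolongation_def Cl.valuation_ring_of_subfield_iff[OF L(1)])
  have "(Cl.algebraic over base F) x" if "x \<in> L" for x
    using Cl.algebraic_extension subfieldE(3)[OF L(1)] that by blast
  moreover have "\<exists>!T. Cl.valuation_subring L T \<and> T \<inter> base F = emb F ` V"
  proof -
    have "\<exists>!T. prolongation F V L T" using V ext by (simp add: henselian_def)
    then show ?thesis unfolding prol .
  qed
  moreover have "valuation_ring F V" using V by (simp add: henselian_def)
  ultimately show "\<exists>!T. prolongation F W L T"
    unfolding prol
    using Cl.unique_prolongation_coarsening[OF L(1) subfield_base L(2) _
        valuation_subring_emb valuation_subring_emb[OF W] image_mono[OF assms(3)]] by simp
qed

section \<open>The field \<open>F(p)\<close>, separably closed fields and henselian
  valuations\<close>

lemma min_poly_base: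
  assumes x: "x \<in> base F"
  shows "min_poly F x = [\<one>\<^bsub>field.alg_closure F\<^esub>, \<ominus>\<^bsub>field.alg_closure F\<^esub> x]"
proof -
  let ?p = "[\<one>\<^bsub>field.alg_closure F\<^esub>, \<ominus>\<^bsub>field.alg_closure F\<^esub> x]"
  note E = subringE[OF subfieldE(1)[OF subfield_base]]
  have xc: "x \<in> carrier (field.alg_closure F)" using x E(1) by auto
  have p: "?p \<in> carrier (univ_poly (field.alg_closure F) (base F))"
    using x E by (auto simp: univ_poly_def polynomial_def)
  have irr: "ring_irreducible\<^bsub>univ_poly (field.alg_closure F) (base F)\<^esub> ?p"
    using Cl.degree_one_imp_pirreducible[OF subfield_base p] by simp
  have "Cl.eval ?p x = \<zero>\<^bsub>field.alg_closure F\<^esub>"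
    using xc by (simp add: Cl.r_neg)
  then show ?thesis
    unfolding min_poly_def Cl.Irr_def
    using Cl.minimal_polynomial_is_unique[OF subfield_base xc Cl.algebraic_extension[OF xc]] p irr
    by (intro the1_equality) auto
qed

text \<open>The extension of degree \<open>p^0 = 1\<close>. It makes the family generating
  \<open>F(p)\<close> contain the base field.\<close>

lemma galois_p_extension_base: "galois_p_extension F p (base F)"
proof -
  have alg: "algebraic_extension F (base F)"
    by (simp add: algebraic_extension_def subfield_base)
  have car: "x \<in> carrier (field.alg_closure F)" if "x \<in> base F" for x
    using that subfieldE(3)[OF subfield_base] by auto
  have "separable_elt F x" if x: "x \<in> base F" for x
  proof -
    let ?p = "[\<one>\<^bsub>field.alg_closure F\<^esub>, \<ominus>\<^bsub>field.alg_closure F\<^esub> x]"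
    have "?p \<in> carrier (poly_ring (field.alg_closure F))"
      using car[OF x] by (auto simp: univ_poly_def polynomial_def)
    \<comment> \<open>The minimal polynomial is \<open>X - x\<close>, whose only root
      \<open>x\<close> is simple.\<close>
    then have "Cl.alg_mult ?p = count {#x#}"
      using Cl.alg_mult_eq_count_roots Cl.monic_degree_one_roots[OF car[OF x]] by metis
    then show ?thesis by (simp add: separable_elt_def min_poly_base[OF x])
  qed
  moreover have "y \<in> base F" if "x \<in> base F" "Cl.is_root (min_poly F x) y" for x y
    using that Cl.monic_degree_one_root_condition[OF car[OF that(1)]] by (simp add: min_poly_base)
  moreover have "Cl.dimension (p ^ 0) (base F) (base F)"
    using Cl.dimension_one[OF subfield_base] by simp
  ultimately show ?thesis
    using alg unfolding galois_p_extension_def galois_extension_def normal_extension_def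
      separable_extension_def by blast
qed

lemma galois_p_extensions_in_carrier:
  "\<Union>{L. galois_p_extension F p L} \<subseteq> carrier (field.alg_closure F)"
  using subfieldE(3) unfolding galois_p_extension_def galois_extension_def normal_extension_def
    algebraic_extension_def by blast

text \<open>Places \<open>F(p)\<close> among the extensions to which a henselian valuation prolongs
  uniquely; this gives \<open>henselian_imp_p_henselian\<close>.\<close>

lemma algebraic_extension_p_closure: "algebraic_extension F (p_closure F p)"
  unfolding algebraic_extension_def p_closure_def
proof
  let ?G = "\<Union>{L. galois_p_extension F p L}"
  show "subfield (generate_field (field.alg_closure F) ?G) (field.alg_closure F)"
    by (rule Cl.generate_field_is_subfield[OF galois_p_extensions_in_carrier])
  show "base F \<subseteq> generate_field (field.alg_closure F) ?G"
    using galois_p_extension_base by (blast intro: generate_field.incl)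
qed

text \<open>A Galois extension consists of separable elements, so each generator of
  \<open>F(p)\<close> already lies in the base field.\<close>

lemma separably_closed_imp_p_closed:
  assumes "separably_closed F"
  shows "p_closed F p"
proof -
  have "L \<subseteq> base F" if "galois_p_extension F p L" for L
  proof
    fix x assume x: "x \<in> L"
    have "separable_elt F x" "x \<in> carrier (field.alg_closure F)"
      using that x galois_p_extensions_in_carrier
      unfolding galois_p_extension_def galois_extension_def separable_extension_def by auto
    then show "x \<in> base F" using assms by (auto simp: separably_closed_def separable_closure_def)
  qed
  then have "p_closure F p \<subseteq> base F"
    unfolding p_closure_def
    by (intro Cl.generate_field_min_subfield1[OF galois_p_extensions_in_carrier subfield_base]) auto
  then show ?thesis
    using algebraic_extension_p_closure by (auto simp: p_closed_def algebraic_extension_def)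
qed

lemma henselian_imp_p_henselian: "henselian F V \<Longrightarrow> p_henselian F p V"
  using algebraic_extension_p_closure by (auto simp: henselian_def p_henselian_def)

end

section \<open>Comparison of the two canonical valuations\<close>

theorem mainTheorem8:
  fixes K :: "('a, 'm) ring_scheme" and p :: nat and V Vp :: "'a set"
  assumes "henselian_field K"
    and "Factorial_Ring.prime p"
    and "\<not> p_closed K p"
    and "canonical_henselian_valuation K V"
    and "canonical_p_henselian_valuation K p Vp"
  shows "henselian K Vp \<longleftrightarrow> V \<subseteq> Vp"
proof
  have K: "field K" using assms(1) by (simp add: henselian_field_def)
  have V: "henselian K V"
    using assms(4) by (auto simp: canonical_henselian_valuation_def coarsest_in_def finest_in_def
        H1_def H2_def split: if_splits)
  have Vp: "valuation_ring K Vp"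
    using assms(5) by (auto simp: canonical_p_henselian_valuation_def coarsest_in_def finest_in_def
        H1p_def H2p_def p_henselian_def split: if_splits)
  show "henselian K Vp" if "V \<subseteq> Vp"
    using henselian_coarsening[OF K V Vp that] .
  show "V \<subseteq> Vp" if Vp_hens: "henselian K Vp"
  proof (cases "H2 K = {}")
    case True
    then have "Vp \<in> H1 K" using Vp_hens by (auto simp: H1_def H2_def)
    then show ?thesis
      using assms(4) True by (simp add: canonical_henselian_valuation_def finest_in_def)
  next
    case False
    then have "separably_closed (residue_field K V)"
      using assms(4) by (simp add: canonical_henselian_valuation_def coarsest_in_def H2_def)
    moreover have "field (residue_field K V)"
      using field.residue_field_is_field[OF K] V by (simp add: henselian_def)
    ultimately have "V \<in> H2p K p"
      using henselian_imp_p_henselian[OF K V] separably_closed_imp_p_closed by (simp add: H2p_def)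
    \<comment> \<open>The ring \<open>V\<close> itself witnesses that \<open>H2p K p\<close> is
      nonempty, which selects the coarsest-element branch in the definition of
      \<open>Vp\<close>.\<close>
    moreover from this have "coarsest_in (H2p K p) Vp"
      using assms(5) unfolding canonical_p_henselian_valuation_def by (metis empty_iff)
    ultimately show ?thesis by (simp add: coarsest_in_def)
  qed
qed

end
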